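(* For each integer $d \geq 3$, there exist a regular triangulation of a configuration of $(2d+1)(d+1)$ points in $\mathbb{R}^{d}$ and a point $\mathbf{x}^{*}$ in the interior of one of the simplices of the triangulation such that every ray emanating from $\mathbf{x}^{*}$ intersects at least $2^{d-1}$ simplices of the triangulation.
   Context: Let $V$ be a finite set of points in $\mathbb{R}^d$ such that $\mathrm{conv}(V)$ is $d$-dimensional. A subdivision of $V$ is a collection of $d$-dimensional polytopes (cells) whose union is $\mathrm{conv}(V)$ and such that the intersection of any two cells is empty or a single face of both; the vertices of the cells are points of $V$. It is a triangulation if all cells are ($d$-dimensional) simplices. A subdivision is regular if there is a weight function $w$ on $V$ such that the cells are exactly the projections to $\mathbb{R}^d$ (forgetting the last coordinate) of the upper-hull facets of $\mathrm{conv}\{(\mathbf{p}, w(\mathbf{p})) : \mathbf{p}\in V\} \subset \mathbb{R}^{d+1}$, i.e. the facets whose outer normal has positive last coordinate. The simplices counted are the $d$-dimensional simplices of the triangulation. A ray emanating from $\mathbf{x}^*$ is a set $\{\mathbf{x}^*+\lambda \mathbf{u} : \lambda \geq 0\}$ with $\mathbf{u} \neq \mathbf{0}$. *)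

theory Defs
  imports "HOL-Analysis.Analysis"
begin

definition subdivision_of :: "'a::euclidean_space set set \<Rightarrow> 'a set \<Rightarrow> bool"
  where "subdivision_of \<T> V \<longleftrightarrow>
    (\<forall>C\<in>\<T>. polytope C \<and> aff_dim C = int DIM('a) \<and> {v. v extreme_point_of C} \<subseteq> V) \<and>
    \<Union>\<T> = convex hull V \<and>
    (\<forall>C\<in>\<T>. \<forall>D\<in>\<T>. (C \<inter> D) face_of C \<and> (C \<inter> D) face_of D)"

(* Unlike the library's "triangulation", all simplices are full-dimensional and they cover
   the convex hull of V. *)
definition triangulation_of :: "'a::euclidean_space set set \<Rightarrow> 'a set \<Rightarrow> bool"
  where "triangulation_of \<T> V \<longleftrightarrow>
    subdivision_of \<T> V \<and> (\<forall>C\<in>\<T>. int DIM('a) simplex C)"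

definition lifted_polytope :: "'a::euclidean_space set \<Rightarrow> ('a \<Rightarrow> real) \<Rightarrow> ('a \<times> real) set"
  where "lifted_polytope V w = convex hull ((\<lambda>p. (p, w p)) ` V)"

(* If P is full-dimensional in 'a \<times> real, these are exactly the facets of P with an outer normal
   whose last coordinate is positive.  The alternative F = P and the condition on aff_dim only
   matter if P lies in a non-vertical hyperplane (w affine on V): then P is its own upper hull,
   while its relative facets, whose outer normals are not unique, are not counted. *)
definition upper_facet_of :: "('a::euclidean_space \<times> real) set \<Rightarrow> ('a \<times> real) set \<Rightarrow> bool"
  where "upper_facet_of F P \<longleftrightarrow>
    (F facet_of P \<or> F = P) \<and> aff_dim F = int DIM('a) \<and>
    (\<exists>a b. snd a > 0 \<and> P \<subseteq> {x. a \<bullet> x \<le> b} \<and> F = P \<inter> {x. a \<bullet> x = b})"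

definition regular_subdivision_of :: "'a::euclidean_space set set \<Rightarrow> 'a set \<Rightarrow> bool"
  where "regular_subdivision_of \<T> V \<longleftrightarrow>
    subdivision_of \<T> V \<and>
    (\<exists>w. \<T> = {fst ` F | F. upper_facet_of F (lifted_polytope V w)})"

definition ray_from :: "'a::real_vector \<Rightarrow> 'a \<Rightarrow> 'a set"
  where "ray_from x u = {x + l *\<^sub>R u | l. l \<ge> 0}"

end

theory Submission
  imports Defs "HOL-Computational_Algebra.Polynomial"
begin

text \<open>Place \<open>d + 1\<close> configurations of \<open>2 d\<close> points around a simplex centred at \<open>0\<close>, one for
each of the \<open>d + 1\<close> simplicial cones spanned by its vertices. In a configuration with apex \<open>p\<close> and
basis \<open>b\<^sub>0, \<dots>, b\<^sub>d\<^sub>-\<^sub>1\<close>, where \<open>b\<^sub>d\<^sub>-\<^sub>1\<close> is a small multiple of \<open>p\<close>, the other points are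
\<open>p + 2 d (\<plusminus> b\<^sub>k + 3 b\<^sub>k\<^sub>-\<^sub>1)\<close> (with \<open>+ b\<^sub>0\<close> only, and \<open>0\<close> for \<open>b\<^sub>-\<^sub>1\<close>), and each choice of signs gives a cell, the simplex on \<open>p\<close> and the
points with these signs. The coordinates of a point of the ray with respect to a cell are linked by
\<open>3 \<nu>\<^sub>k\<^sub>+\<^sub>1 = y\<^sub>k \<mp> \<nu>\<^sub>k\<close> with \<open>y\<^sub>k \<in> [1, 2]\<close>. Like an expanding tent map, this recursion realises every
sign pattern with all \<open>\<nu>\<^sub>k \<in> [0, 1]\<close>, so every ray in the cone meets all \<open>2\<^sup>d\<^sup>-\<^sup>1\<close> cells; this is the
section of a dual Goldfarb cube. Heights \<open>-10\<^sup>k\<close> on the \<open>k\<close>-th pair of points make all these cells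
strictly upper. The configurations are scaled to very different sizes, so that successive
hyperplanes separate them, and adding steep concave functions bent along these hyperplanes merges
the heights without destroying any cell. Strict cells survive a generic perturbation of the heights,
which turns the regular subdivision into a triangulation.\<close>

subsection \<open>Regular subdivisions\<close>

text \<open>The pair \<open>z\<close>, \<open>c\<close> encodes the graph of
  \<open>x \<mapsto> z \<bullet> x + c\<close>: only non-vertical hyperplanes occur, and the normal
  \<open>(- z, 1)\<close> points upwards.\<close>

definition contact_set :: "'a::euclidean_space set \<Rightarrow> ('a \<Rightarrow> real) \<Rightarrow> 'a \<Rightarrow> real \<Rightarrow> 'a set"
  where "contact_set V w z c = {v \<in> V. w v = z \<bullet> v + c}"

definition upper_plane :: "'a::euclidean_space set \<Rightarrow> ('a \<Rightarrow> real) \<Rightarrow> 'a \<Rightarrow> real \<Rightarrow> bool"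
  where "upper_plane V w z c \<longleftrightarrow>
    (\<forall>v\<in>V. w v \<le> z \<bullet> v + c) \<and> aff_dim (contact_set V w z c) = int DIM('a)"

definition upper_cells :: "'a::euclidean_space set \<Rightarrow> ('a \<Rightarrow> real) \<Rightarrow> 'a set set"
  where "upper_cells V w = {convex hull contact_set V w z c | z c. upper_plane V w z c}"

text \<open>A face of the hull of a compact set is the hull of some of the generators, so the
  hyperplane may be intersected with the generators first.\<close>

lemma convex_hull_Int_supporting_hyperplane:
  fixes S :: "'a::euclidean_space set"
  assumes "finite S" and le: "\<And>x. x \<in> S \<Longrightarrow> a \<bullet> x \<le> b"
  shows "convex hull S \<inter> {x. a \<bullet> x = b} = convex hull (S \<inter> {x. a \<bullet> x = b})"
    and "(convex hull S \<inter> {x. a \<bullet> x = b}) face_of convex hull S"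
proof -
  let ?F = "convex hull S \<inter> {x. a \<bullet> x = b}"
  have "convex hull S \<subseteq> {x. a \<bullet> x \<le> b}"
    using le by (intro hull_minimal) (auto simp: convex_halfspace_le)
  then show face: "?F face_of convex hull S"
    by (intro face_of_Int_supporting_hyperplane_le) auto
  obtain S' where S': "S' \<subseteq> S" "?F = convex hull S'"
    using face_of_convex_hull_subset[OF finite_imp_compact[OF \<open>finite S\<close>] face] by blast
  then have "S' \<subseteq> S \<inter> {x. a \<bullet> x = b}"
    using hull_subset[of S' convex] by blast
  then have "?F \<subseteq> convex hull (S \<inter> {x. a \<bullet> x = b})"
    unfolding S' by (rule hull_mono)
  moreover have "convex hull (S \<inter> {x. a \<bullet> x = b}) \<subseteq> ?F"
    using hull_subset[of S convex]
    by (intro hull_minimal) (auto intro!: convex_Int convex_hyperplane)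
  ultimately show "?F = convex hull (S \<inter> {x. a \<bullet> x = b})" ..
qed

lemma aff_dim_graph:
  fixes S :: "'a::euclidean_space set"
  shows "aff_dim ((\<lambda>x. (x, z \<bullet> x + c)) ` S) = aff_dim S"
proof -
  have lin: "linear (\<lambda>x. (x, z \<bullet> x))"
    by (rule linearI) (auto simp: inner_add_right)
  have "(\<lambda>x. (x, z \<bullet> x + c)) ` S = (+) (0, c) ` (\<lambda>x. (x, z \<bullet> x)) ` S"
    by (auto simp: image_image add.commute)
  then show ?thesis
    using lin by (simp add: aff_dim_translation_eq inj_on_def)
qed

lemma lifted_contact_set:
  "(\<lambda>p. (p, w p)) ` contact_set V w z c = (\<lambda>x. (x, z \<bullet> x + c)) ` contact_set V w z c"
  by (auto simp: contact_set_def)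

lemma fst_convex_hull_lift:
  "fst ` (convex hull ((\<lambda>p. (p, w p)) ` S)) = convex hull S"
  by (subst convex_hull_linear_image) (auto simp: linear_fst image_image)

text \<open>Every normal with positive last coordinate has the form
  \<open>(- k *\<^sub>R z, k)\<close>; dividing by \<open>k\<close> turns contact with the
  hyperplane into \<open>w v = z \<bullet> v + c\<close>.\<close>

lemma lifted_polytope_Int_hyperplane:
  fixes V :: "'a::euclidean_space set"
  assumes "finite V" "k > 0" "\<And>v. v \<in> V \<Longrightarrow> w v \<le> z \<bullet> v + c"
  shows "lifted_polytope V w \<inter> {x. (- k *\<^sub>R z, k) \<bullet> x = k * c} =
      convex hull ((\<lambda>p. (p, w p)) ` contact_set V w z c)"
    and "(lifted_polytope V w \<inter> {x. (- k *\<^sub>R z, k) \<bullet> x = k * c}) face_of lifted_polytope V w"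
    and "lifted_polytope V w \<subseteq> {x. (- k *\<^sub>R z, k) \<bullet> x \<le> k * c}"
proof -
  have *: "(- k *\<^sub>R z, k) \<bullet> (v, w v) \<le> k * c" if "v \<in> V" for v
  proof -
    have "k * w v \<le> k * (z \<bullet> v + c)"
      using assms that by (intro mult_left_mono) auto
    then show ?thesis by (simp add: algebra_simps)
  qed
  have eq: "(- k *\<^sub>R z, k) \<bullet> (v, w v) = k * c \<longleftrightarrow> w v = z \<bullet> v + c" for v
  proof -
    have "(- k *\<^sub>R z, k) \<bullet> (v, w v) = k * c \<longleftrightarrow> k * w v = k * (z \<bullet> v + c)"
      by (auto simp: algebra_simps)
    then show ?thesis using \<open>k > 0\<close> by simp
  qed
  have "((\<lambda>p. (p, w p)) ` V) \<inter> {x. (- k *\<^sub>R z, k) \<bullet> x = k * c} =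
      (\<lambda>p. (p, w p)) ` {v \<in> V. (- k *\<^sub>R z, k) \<bullet> (v, w v) = k * c}"
    by blast
  also have "\<dots> = (\<lambda>p. (p, w p)) ` contact_set V w z c"
    unfolding contact_set_def eq ..
  finally have "((\<lambda>p. (p, w p)) ` V) \<inter> {x. (- k *\<^sub>R z, k) \<bullet> x = k * c} =
      (\<lambda>p. (p, w p)) ` contact_set V w z c" .
  note contact = this
  have "finite ((\<lambda>p. (p, w p)) ` V)"
    using \<open>finite V\<close> by simp
  note hull = convex_hull_Int_supporting_hyperplane[OF this, of "(- k *\<^sub>R z, k)" "k * c"]
  show "lifted_polytope V w \<inter> {x. (- k *\<^sub>R z, k) \<bullet> x = k * c} =
      convex hull ((\<lambda>p. (p, w p)) ` contact_set V w z c)"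
    and "(lifted_polytope V w \<inter> {x. (- k *\<^sub>R z, k) \<bullet> x = k * c}) face_of lifted_polytope V w"
    unfolding lifted_polytope_def contact[symmetric] by (rule hull; use * in blast)+
  show "lifted_polytope V w \<subseteq> {x. (- k *\<^sub>R z, k) \<bullet> x \<le> k * c}"
    unfolding lifted_polytope_def using *
    by (intro hull_minimal) (auto simp: convex_halfspace_le simp del: inner_Pair)
qed

lemma projected_upper_facets:
  fixes V :: "'a::euclidean_space set"
  assumes "finite V"
  shows "{fst ` F | F. upper_facet_of F (lifted_polytope V w)} = upper_cells V w"
proof -
  have "fst ` F \<in> upper_cells V w" if F: "upper_facet_of F (lifted_polytope V w)" for F
  proof -
    obtain a b where a: "snd a > 0" "lifted_polytope V w \<subseteq> {x. a \<bullet> x \<le> b}"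
      and Feq: "F = lifted_polytope V w \<inter> {x. a \<bullet> x = b}" and dim: "aff_dim F = int DIM('a)"
      using F unfolding upper_facet_of_def by blast
    define k where "k = snd a"
    define z where "z = - (1 / k) *\<^sub>R fst a"
    define c where "c = b / k"
    have "k > 0" using a by (simp add: k_def)
    have ab: "a = (- k *\<^sub>R z, k)" "b = k * c"
      using \<open>k > 0\<close> by (auto simp: z_def c_def k_def)
    have le: "w v \<le> z \<bullet> v + c" if "v \<in> V" for v
    proof -
      have "(v, w v) \<in> lifted_polytope V w"
        unfolding lifted_polytope_def using that by (intro hull_inc) auto
      then have "a \<bullet> (v, w v) \<le> b" using a(2) by blast
      then have "k * w v \<le> k * (z \<bullet> v + c)" by (simp add: ab algebra_simps)
      then show ?thesis using \<open>k > 0\<close> by simp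
    qed
    have F': "F = convex hull ((\<lambda>p. (p, w p)) ` contact_set V w z c)"
      unfolding Feq ab by (rule lifted_polytope_Int_hyperplane(1)[OF \<open>finite V\<close> \<open>k > 0\<close> le])
    have "aff_dim (contact_set V w z c) = int DIM('a)"
      using dim by (simp only: F' aff_dim_convex_hull lifted_contact_set aff_dim_graph)
    then show ?thesis
      unfolding upper_cells_def upper_plane_def F' fst_convex_hull_lift using le by blast
  qed
  moreover have "\<exists>F. convex hull contact_set V w z c = fst ` F \<and>
      upper_facet_of F (lifted_polytope V w)" if "upper_plane V w z c" for z c
  proof -
    have le: "\<And>v. v \<in> V \<Longrightarrow> w v \<le> z \<bullet> v + c"
      and dim: "aff_dim (contact_set V w z c) = int DIM('a)"
      using that unfolding upper_plane_def by auto
    note * = lifted_polytope_Int_hyperplane[OF \<open>finite V\<close> zero_less_one le]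
    define P where "P = lifted_polytope V w"
    define F where "F = P \<inter> {x. (- 1 *\<^sub>R z, 1) \<bullet> x = 1 * c}"
    have Fhull: "F = convex hull ((\<lambda>p. (p, w p)) ` contact_set V w z c)"
      unfolding F_def P_def by (rule *(1))
    have Fdim: "aff_dim F = int DIM('a)"
      unfolding Fhull aff_dim_convex_hull lifted_contact_set aff_dim_graph by (rule dim)
    have Fface: "F face_of P"
      unfolding F_def P_def by (rule *(2))
    \<comment> \<open>The ambient dimension is \<open>DIM('a) + 1\<close>, so a proper face of
      dimension \<open>DIM('a)\<close> has codimension one.\<close>
    have "F facet_of P" if "F \<noteq> P"
    proof -
      have "convex P" unfolding P_def lifted_polytope_def by simp
      then have "aff_dim F < aff_dim P"
        using face_of_aff_dim_lt Fface that by blast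
      moreover have "aff_dim P \<le> int DIM('a) + 1"
        using aff_dim_le_DIM[of P] by simp
      moreover have "F \<noteq> {}" using Fdim by auto
      ultimately show ?thesis using Fface Fdim by (auto simp: facet_of_def)
    qed
    moreover have "\<exists>a b. snd a > 0 \<and> P \<subseteq> {x. a \<bullet> x \<le> b} \<and> F = P \<inter> {x. a \<bullet> x = b}"
      using *(3) unfolding F_def P_def by (intro exI[of _ "(- 1 *\<^sub>R z, 1)"] exI[of _ "1 * c"]) auto
    ultimately have "upper_facet_of F P"
      unfolding upper_facet_of_def using Fdim by blast
    then show ?thesis
      unfolding P_def using Fhull fst_convex_hull_lift by metis
  qed
  ultimately show ?thesis
    unfolding upper_cells_def by blast
qed

text \<open>Each plane is the lower of the two over its own contact set, so the hyperplane where the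
  planes agree separates the cells and cuts both along their intersection.\<close>

lemma upper_cells_Int_face:
  fixes V :: "'a::euclidean_space set"
  assumes "finite V" "upper_plane V w z c" "upper_plane V w z' c'"
  shows "(convex hull contact_set V w z c \<inter> convex hull contact_set V w z' c')
     face_of convex hull contact_set V w z c"
proof -
  let ?A = "contact_set V w z c" and ?B = "contact_set V w z' c'"
  let ?H = "{x. (z - z') \<bullet> x = c' - c}"
  have le: "w v \<le> z \<bullet> v + c" "w v \<le> z' \<bullet> v + c'" if "v \<in> V" for v
    using assms that by (auto simp: upper_plane_def)
  have A: "(z - z') \<bullet> x \<le> c' - c" if "x \<in> ?A" for x
    using le that by (force simp: contact_set_def inner_diff_left)
  have "finite ?A"
    using \<open>finite V\<close> by (simp add: contact_set_def)
  note face = convex_hull_Int_supporting_hyperplane[OF this A]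
  have "?A \<inter> ?H \<subseteq> ?B"
    by (auto simp: contact_set_def inner_diff_left)
  then have "convex hull ?A \<inter> ?H \<subseteq> convex hull ?B"
    using face(1) hull_mono by metis
  moreover have "?B \<subseteq> {x. (z - z') \<bullet> x \<ge> c' - c}"
    using le by (force simp: contact_set_def inner_diff_left)
  then have "convex hull ?B \<subseteq> {x. (z - z') \<bullet> x \<ge> c' - c}"
    using convex_halfspace_ge by (intro hull_minimal)
  moreover have "convex hull ?A \<subseteq> {x. (z - z') \<bullet> x \<le> c' - c}"
    using A by (intro hull_minimal) (auto simp: convex_halfspace_le)
  ultimately have "convex hull ?A \<inter> convex hull ?B = convex hull ?A \<inter> ?H"
    by force
  then show ?thesis
    using face(2) by simp
qed

text \<open>The highest point of \<open>P\<close> above \<open>x\<close> must lie on the boundary of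
  a defining halfspace whose normal points upwards.\<close>

lemma polyhedron_upper_point:
  fixes P :: "('a::euclidean_space \<times> real) set"
  assumes "polytope P" "aff_dim P = int DIM('a) + 1" "x \<in> fst ` P"
  obtains F where "x \<in> fst ` F" "upper_facet_of F P"
proof -
  have "affine hull P = UNIV"
    using assms(2) aff_dim_eq_full[of P] by simp
  moreover have "polyhedron P"
    using assms(1) by (rule polytope_imp_polyhedron)
  \<comment> \<open>With no halfspace redundant, each bounding hyperplane cuts out a facet.\<close>
  ultimately obtain H where "finite H" and H: "P = affine hull P \<inter> \<Inter>H"
      and half: "\<forall>h\<in>H. \<exists>a b. a \<noteq> 0 \<and> h = {x. a \<bullet> x \<le> b}"
      and minimal: "\<forall>H'. H' \<subset> H \<longrightarrow> P \<subset> affine hull P \<inter> \<Inter>H'"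
    unfolding polyhedron_Int_affine_minimal by blast
  obtain a b where ab: "\<And>h. h \<in> H \<Longrightarrow> a h \<noteq> 0 \<and> h = {x. a h \<bullet> x \<le> b h}"
    using half by metis
  have Peq: "P = \<Inter>H"
    using H \<open>affine hull P = UNIV\<close> by simp
  have "compact (P \<inter> {y. fst y = x})"
    using assms(1) by (intro compact_Int_closed polytope_imp_compact closed_Collect_eq
        continuous_intros)
  moreover have "P \<inter> {y. fst y = x} \<noteq> {}"
    using assms(3) by auto
  ultimately obtain y where y: "y \<in> P" "fst y = x"
    and top: "\<And>y'. y' \<in> P \<Longrightarrow> fst y' = x \<Longrightarrow> snd y' \<le> snd y"
    using continuous_attains_sup[of "P \<inter> {y. fst y = x}" snd]
    by (auto simp: continuous_on_snd)
  have yle: "a h \<bullet> y \<le> b h" if "h \<in> H" for h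
    using that y(1) ab[OF that] Peq by blast
  \<comment> \<open>Otherwise \<open>y\<close> could be moved upwards within the polytope.\<close>
  have "\<exists>h\<in>H. snd (a h) > 0 \<and> a h \<bullet> y = b h"
  proof (rule ccontr)
    assume none: "\<not> (\<exists>h\<in>H. snd (a h) > 0 \<and> a h \<bullet> y = b h)"
    have "\<forall>\<^sub>F t in at_right 0. a h \<bullet> (y + (0, t)) \<le> b h" if "h \<in> H" for h
    proof (cases "snd (a h) > 0")
      case True
      then have "a h \<bullet> y < b h"
        using none that yle by force
      moreover have "((\<lambda>t. a h \<bullet> (y + (0, t))) \<longlongrightarrow> a h \<bullet> (y + (0, 0))) (at_right 0)"
        by (intro tendsto_intros)
      ultimately have "\<forall>\<^sub>F t in at_right 0. a h \<bullet> (y + (0, t)) < b h"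
        by (intro order_tendstoD(2)[where y = "a h \<bullet> (y + (0, 0))"]) (auto simp: zero_prod_def[symmetric])
      then show ?thesis by (rule eventually_mono) auto
    next
      case False
      have "a h \<bullet> (y + (0, t)) \<le> b h" if "t > 0" for t
      proof -
        have "a h \<bullet> (0, t) = snd (a h) * t" by (cases "a h") simp
        also have "\<dots> \<le> 0" using False that by (simp add: mult_le_0_iff)
        finally show ?thesis using yle[OF \<open>h \<in> H\<close>] by (simp add: inner_add_right)
      qed
      then show ?thesis
        by (auto simp: eventually_at_right_less intro: eventually_mono[OF eventually_at_right_less])
    qed
    then have "\<forall>\<^sub>F t in at_right 0. \<forall>h\<in>H. a h \<bullet> (y + (0, t)) \<le> b h"
      using \<open>finite H\<close> by (intro eventually_ball_finite) auto
    then have "\<forall>\<^sub>F t in at_right 0. (\<forall>h\<in>H. a h \<bullet> (y + (0, t)) \<le> b h) \<and> t > 0"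
      using eventually_at_right_less by (rule eventually_conj)
    then obtain t :: real where "\<forall>h\<in>H. a h \<bullet> (y + (0, t)) \<le> b h" "t > 0"
      using eventually_happens'[of "at_right (0::real)"] by (auto simp: trivial_limit_at_right_real)
    then have "y + (0, t) \<in> P"
      using ab Peq by blast
    then show False using top[of "y + (0, t)"] y \<open>t > 0\<close> by simp
  qed
  then obtain h where h: "h \<in> H" "snd (a h) > 0" "a h \<bullet> y = b h" by blast
  define F where "F = P \<inter> {x. a h \<bullet> x = b h}"
  have "F facet_of P"
    unfolding F_def using facet_of_polyhedron_explicit[OF \<open>finite H\<close> H ab] minimal h(1) by blast
  moreover have "P \<subseteq> {x. a h \<bullet> x \<le> b h}"
    using ab[OF h(1)] h(1) Peq by blast
  moreover have "aff_dim F = int DIM('a)"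
    using \<open>F facet_of P\<close> assms(2) by (simp add: facet_of_def)
  ultimately have "upper_facet_of F P"
    unfolding upper_facet_of_def using h(2) F_def by blast
  moreover have "x \<in> fst ` F"
    using y h(3) by (auto simp: F_def)
  ultimately show ?thesis using that by blast
qed

lemma Union_upper_cells:
  fixes V :: "'a::euclidean_space set"
  assumes "finite V" "aff_dim ((\<lambda>p. (p, w p)) ` V) = int DIM('a) + 1"
  shows "\<Union>(upper_cells V w) = convex hull V"
proof
  show "\<Union>(upper_cells V w) \<subseteq> convex hull V"
    by (auto simp: upper_cells_def contact_set_def intro: subsetD[OF hull_mono, rotated])
  have "polytope (lifted_polytope V w)"
    using assms(1) by (simp add: lifted_polytope_def polytope_convex_hull)
  moreover have "aff_dim (lifted_polytope V w) = int DIM('a) + 1"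
    using assms(2) by (simp add: lifted_polytope_def aff_dim_convex_hull)
  moreover have "fst ` lifted_polytope V w = convex hull V"
    by (simp add: lifted_polytope_def fst_convex_hull_lift)
  ultimately show "convex hull V \<subseteq> \<Union>(upper_cells V w)"
    unfolding projected_upper_facets[OF assms(1), symmetric]
    by (smt (verit) UnionI mem_Collect_eq polyhedron_upper_point subsetI)
qed

lemma regular_subdivision_upper_cells:
  fixes V :: "'a::euclidean_space set"
  assumes "finite V" "aff_dim ((\<lambda>p. (p, w p)) ` V) = int DIM('a) + 1"
  shows "regular_subdivision_of (upper_cells V w) V"
proof -
  have "polytope C \<and> aff_dim C = int DIM('a) \<and> {v. v extreme_point_of C} \<subseteq> V"
    if C: "C \<in> upper_cells V w" for C
  proof -
    obtain z c where C: "C = convex hull contact_set V w z c" and "upper_plane V w z c"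
      using C unfolding upper_cells_def by blast
    moreover have "contact_set V w z c \<subseteq> V"
      by (auto simp: contact_set_def)
    ultimately show ?thesis
      using finite_subset[OF _ \<open>finite V\<close>]
      by (auto simp: upper_plane_def aff_dim_convex_hull intro!: polytope_convex_hull
          dest: extreme_point_of_convex_hull)
  qed
  moreover have "(C \<inter> D) face_of C \<and> (C \<inter> D) face_of D"
    if "C \<in> upper_cells V w" "D \<in> upper_cells V w" for C D
    using that upper_cells_Int_face[OF \<open>finite V\<close>] unfolding upper_cells_def
    by (auto simp: Int_commute) (metis Int_commute)
  ultimately have "subdivision_of (upper_cells V w) V"
    unfolding subdivision_of_def using Union_upper_cells[OF assms] by simp
  then show ?thesis
    unfolding regular_subdivision_of_def using projected_upper_facets[OF assms(1)] by metis
qed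

subsection \<open>Strict cells and generic heights\<close>

text \<open>For finite \<open>B\<close> this is affine independence in dual form: it is proved by
  solving for a functional, and it yields the barycentric coordinate functions.\<close>

definition interpolable :: "'a::euclidean_space set \<Rightarrow> bool"
  where "interpolable B \<longleftrightarrow> (\<forall>r. \<exists>z c. \<forall>x\<in>B. z \<bullet> x + c = r x)"

text \<open>The vertex set of a simplicial upper facet whose hyperplane touches no other lifted
  point; this strictness makes the facet stable under perturbation.\<close>

definition strict_cell :: "'a::euclidean_space set \<Rightarrow> ('a \<Rightarrow> real) \<Rightarrow> 'a set \<Rightarrow> bool"
  where "strict_cell V w B \<longleftrightarrow> B \<subseteq> V \<and> card B = Suc DIM('a) \<and> interpolable B \<and>
    (\<exists>z c. (\<forall>v\<in>B. w v = z \<bullet> v + c) \<and> (\<forall>v\<in>V - B. w v < z \<bullet> v + c))"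

text \<open>One violated affine relation suffices to keep the lifted \<open>u\<close> off every
  non-vertical hyperplane through the lifted \<open>B\<close>.\<close>

definition generic_heights :: "'a::euclidean_space set \<Rightarrow> ('a \<Rightarrow> real) \<Rightarrow> bool"
  where "generic_heights V w \<longleftrightarrow> (\<forall>B\<subseteq>V. \<forall>u\<in>V - B. affine hull B = UNIV \<longrightarrow>
    (\<exists>l. sum l B = 1 \<and> (\<Sum>b\<in>B. l b *\<^sub>R b) = u \<and> w u \<noteq> (\<Sum>b\<in>B. l b * w b)))"

text \<open>An affine function that is 1 at \<open>v\<close> and 0 on the rest of \<open>B\<close>
  picks the coefficient of \<open>v\<close> out of an affine dependence.\<close>

lemma interpolable_affine_independent:
  assumes "finite B" "interpolable B"
  shows "\<not> affine_dependent B"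
proof
  assume "affine_dependent B"
  then obtain U v where U: "sum U B = 0" "v \<in> B" "U v \<noteq> 0" "(\<Sum>x\<in>B. U x *\<^sub>R x) = 0"
    unfolding affine_dependent_explicit_finite[OF \<open>finite B\<close>] by blast
  obtain z c where zc: "\<And>x. x \<in> B \<Longrightarrow> z \<bullet> x + c = (if x = v then 1 else 0)"
    using assms(2)[unfolded interpolable_def, rule_format, of "\<lambda>x. if x = v then 1 else 0"] by blast
  have "U v = (\<Sum>x\<in>B. U x * (if x = v then 1 else 0))"
    using \<open>finite B\<close> \<open>v \<in> B\<close> by (simp add: if_distrib cong: if_cong)
  also have "\<dots> = (\<Sum>x\<in>B. U x * (z \<bullet> x + c))"
    using zc by (intro sum.cong) auto
  also have "\<dots> = z \<bullet> (\<Sum>x\<in>B. U x *\<^sub>R x) + c * sum U B"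
    by (simp add: inner_sum_right sum.distrib distrib_left sum_distrib_left mult.commute)
  finally show False using U by simp
qed

lemma strict_cell_affine_independent:
  fixes B :: "'a::euclidean_space set"
  assumes "strict_cell V w B"
  shows "\<not> affine_dependent B" "aff_dim B = int DIM('a)"
proof -
  have "finite B"
    using assms unfolding strict_cell_def by (metis card.infinite nat.distinct(1))
  then show "\<not> affine_dependent B"
    using assms interpolable_affine_independent by (auto simp: strict_cell_def)
  then show "aff_dim B = int DIM('a)"
    using assms affine_independent_iff_card[of B] by (auto simp: strict_cell_def)
qed

lemma strict_cell_upper_plane:
  fixes V :: "'a::euclidean_space set"
  assumes "strict_cell V w B"
  obtains z c where "upper_plane V w z c" "contact_set V w z c = B"
proof -
  obtain z c where zc: "\<And>v. v \<in> B \<Longrightarrow> w v = z \<bullet> v + c" "\<And>v. v \<in> V - B \<Longrightarrow> w v < z \<bullet> v + c"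
    using assms unfolding strict_cell_def by blast
  have "contact_set V w z c = B"
    using zc assms by (force simp: contact_set_def strict_cell_def)
  moreover have "\<forall>v\<in>V. w v \<le> z \<bullet> v + c"
    using zc by (metis DiffI less_eq_real_def)
  ultimately show ?thesis
    using that strict_cell_affine_independent(2)[OF assms] by (auto simp: upper_plane_def)
qed

text \<open>The barycentric coordinate functions \<open>Z b\<close>, \<open>C b\<close> correct the
  plane to the new heights on \<open>B\<close>; elsewhere it moves too little to close the
  gap.\<close>

lemma strict_cell_open:
  fixes V :: "'a::euclidean_space set"
  assumes "finite V" "strict_cell V w B"
  shows "\<exists>e>0. \<forall>w'. (\<forall>v\<in>V. \<bar>w' v - w v\<bar> < e) \<longrightarrow> strict_cell V w' B"
proof -
  obtain z c where zc: "\<And>v. v \<in> B \<Longrightarrow> w v = z \<bullet> v + c" "\<And>v. v \<in> V - B \<Longrightarrow> w v < z \<bullet> v + c"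
    using assms(2) unfolding strict_cell_def by blast
  have B: "B \<subseteq> V" "card B = Suc DIM('a)" "interpolable B"
    using assms(2) unfolding strict_cell_def by auto
  then have "finite B"
    using \<open>finite V\<close> finite_subset by blast
  have "\<exists>z c. \<forall>x\<in>B. z \<bullet> x + c = (if x = b then 1 else 0)" for b
    using B(3)[unfolded interpolable_def, rule_format, of "\<lambda>x. if x = b then 1 else 0"] .
  then obtain Z C where ZC: "\<And>b x. x \<in> B \<Longrightarrow> Z b \<bullet> x + C b = (if x = b then 1 else 0)"
    by metis
  \<comment> \<open>\<open>K\<close> bounds the movement of the plane at any point of
    \<open>V\<close> per unit of perturbation, plus 1 for the movement of the point itself.\<close>
  define K where "K = 1 + (\<Sum>v\<in>V. \<Sum>b\<in>B. \<bar>Z b \<bullet> v + C b\<bar>)"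
  have "K \<ge> 1" by (simp add: K_def sum_nonneg)
  have K: "1 + (\<Sum>b\<in>B. \<bar>Z b \<bullet> v + C b\<bar>) \<le> K" if "v \<in> V" for v
    using member_le_sum[OF that, of "\<lambda>v. \<Sum>b\<in>B. \<bar>Z b \<bullet> v + C b\<bar>"] \<open>finite V\<close>
    by (simp add: K_def sum_nonneg)
  \<comment> \<open>The least gap below the plane; the inserted 1 covers the case
    \<open>V = B\<close>.\<close>
  define m where "m = Min (insert 1 ((\<lambda>v. z \<bullet> v + c - w v) ` (V - B)))"
  have "m > 0"
    unfolding m_def using \<open>finite V\<close> zc(2) by (simp add: Min_gr_iff)
  have m: "m \<le> z \<bullet> v + c - w v" if "v \<in> V - B" for v
    unfolding m_def using \<open>finite V\<close> that by (intro Min_le) auto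
  have "strict_cell V w' B" if w': "\<forall>v\<in>V. \<bar>w' v - w v\<bar> < m / K" for w'
  proof -
    define z' where "z' = z + (\<Sum>b\<in>B. (w' b - w b) *\<^sub>R Z b)"
    define c' where "c' = c + (\<Sum>b\<in>B. (w' b - w b) * C b)"
    have eq: "z' \<bullet> v + c' = z \<bullet> v + c + (\<Sum>b\<in>B. (w' b - w b) * (Z b \<bullet> v + C b))" for v
      by (simp add: z'_def c'_def inner_add_left inner_sum_left sum.distrib distrib_left)
    have "w' v = z' \<bullet> v + c'" if "v \<in> B" for v
    proof -
      have "(\<Sum>b\<in>B. (w' b - w b) * (Z b \<bullet> v + C b)) = (\<Sum>b\<in>B. (w' b - w b) * (if v = b then 1 else 0))"
        using ZC that by simp
      also have "\<dots> = w' v - w v"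
        using \<open>finite B\<close> that by (simp add: if_distrib cong: if_cong)
      finally show ?thesis using eq zc(1)[OF that] by simp
    qed
    moreover have "w' v < z' \<bullet> v + c'" if v: "v \<in> V - B" for v
    proof -
      have "\<bar>\<Sum>b\<in>B. (w' b - w b) * (Z b \<bullet> v + C b)\<bar> \<le> (\<Sum>b\<in>B. m / K * \<bar>Z b \<bullet> v + C b\<bar>)"
        using w' B(1) 
        by (intro order_trans[OF sum_abs] sum_mono)
          (simp add: abs_mult del: times_divide_eq_left, intro mult_right_mono,
            auto intro: less_imp_le)
      then have "\<bar>\<Sum>b\<in>B. (w' b - w b) * (Z b \<bullet> v + C b)\<bar> + m / K \<le>
          m / K * (1 + (\<Sum>b\<in>B. \<bar>Z b \<bullet> v + C b\<bar>))"
        by (simp add: sum_distrib_left distrib_left)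
      also have "\<dots> \<le> m / K * K"
        using K v \<open>m > 0\<close> \<open>K \<ge> 1\<close> by (intro mult_left_mono) auto
      finally have "\<bar>\<Sum>b\<in>B. (w' b - w b) * (Z b \<bullet> v + C b)\<bar> + m / K \<le> m"
        using \<open>K \<ge> 1\<close> by simp
      moreover have "\<bar>w' v - w v\<bar> < m / K"
        using w' v by blast
      ultimately show ?thesis using eq[of v] m[OF v] by linarith
    qed
    ultimately show ?thesis
      unfolding strict_cell_def using B by blast
  qed
  then show ?thesis
    using \<open>m > 0\<close> \<open>K \<ge> 1\<close> by (intro exI[of _ "m / K"]) auto
qed

lemma strict_cells_open:
  fixes V :: "'a::euclidean_space set"
  assumes "finite V" "finite \<B>" "\<And>B. B \<in> \<B> \<Longrightarrow> strict_cell V w B"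
  shows "\<exists>e>0. \<forall>w'. (\<forall>v\<in>V. \<bar>w' v - w v\<bar> < e) \<longrightarrow> (\<forall>B\<in>\<B>. strict_cell V w' B)"
  using assms(2,3)
proof (induction \<B> rule: finite_induct)
  case empty
  show ?case by (intro exI[of _ 1]) auto
next
  case (insert B \<B>)
  obtain e1 where e1: "e1 > 0" "\<And>w'. (\<forall>v\<in>V. \<bar>w' v - w v\<bar> < e1) \<Longrightarrow> strict_cell V w' B"
    using strict_cell_open[OF \<open>finite V\<close>, of w B] insert.prems by blast
  obtain e2 where e2: "e2 > 0"
    "\<And>w'. (\<forall>v\<in>V. \<bar>w' v - w v\<bar> < e2) \<Longrightarrow> (\<forall>B\<in>\<B>. strict_cell V w' B)"
    using insert.IH insert.prems by blast
  show ?case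
    using e1 e2 by (intro exI[of _ "min e1 e2"]) simp
qed

section \<open>Generic perturbation, padding and extension to a triangulation\<close>

lemma exists_generic_heights:
  fixes V :: "'a::euclidean_space set"
  assumes "finite V" "e > 0"
  shows "\<exists>w'. (\<forall>v\<in>V. \<bar>w' v - w v\<bar> < e) \<and> generic_heights V w'"
proof -
  obtain f :: "'a \<Rightarrow> nat" where f: "inj_on f V"
    using finite_imp_inj_to_nat_seg[OF \<open>finite V\<close>] by blast
  \<comment> \<open>Each degeneracy is a polynomial equation in \<open>t\<close> that is not identically satisfied: the
      exponent belonging to \<open>u\<close> occurs in it only once.\<close>
  define h where "h = (\<lambda>t v. w v + t ^ Suc (f v))"
  define I where "I = {(B, u). B \<subseteq> V \<and> u \<in> V - B \<and> affine hull B = UNIV}"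
  have "finite I"
    using \<open>finite V\<close> by (rule_tac finite_subset[of _ "Pow V \<times> V"]) (auto simp: I_def)
  have finV: "finite B" if "B \<subseteq> V" for B
    using that \<open>finite V\<close> finite_subset by blast
  have "\<exists>l. sum l B = 1 \<and> (\<Sum>b\<in>B. l b *\<^sub>R b) = u" if "(B, u) \<in> I" for B u
    using that affine_hull_finite[of B] finV by (auto simp: I_def)
  then obtain L where L: "\<And>B u. (B, u) \<in> I \<Longrightarrow>
      sum (L B u) B = 1 \<and> (\<Sum>b\<in>B. L B u b *\<^sub>R b) = u"
    by metis
  define p where "p = (\<lambda>(B, u). [:w u:] + monom 1 (Suc (f u)) -
      (\<Sum>b\<in>B. smult (L B u b) ([:w b:] + monom 1 (Suc (f b)))))"
  have poly_p: "poly (p (B, u)) t = h t u - (\<Sum>b\<in>B. L B u b * h t b)" for B u t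
    by (simp add: p_def h_def poly_sum poly_monom)
  have "p (B, u) \<noteq> 0" if "(B, u) \<in> I" for B u
  proof -
    have "f b \<noteq> f u" if "b \<in> B" for b
      using f that \<open>(B, u) \<in> I\<close> by (auto simp: I_def inj_on_def)
    \<comment> \<open>The \<open>Suc\<close> in the exponents keeps the constant terms
      \<open>w u\<close> and \<open>w b\<close> out of this coefficient.\<close>
    then have "coeff (p (B, u)) (Suc (f u)) = 1"
      by (simp add: p_def coeff_sum)
    then show ?thesis by auto
  qed
  then have "finite (\<Union>i\<in>I. {t. poly (p i) t = 0})"
    using \<open>finite I\<close> by (intro finite_UN_I poly_roots_finite) auto
  moreover have "infinite {0<..<min e 1}"
    using \<open>e > 0\<close> by (intro infinite_Ioo) simp
  ultimately have "infinite ({0<..<min e 1} - (\<Union>i\<in>I. {t. poly (p i) t = 0}))"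
    by (rule Diff_infinite_finite)
  then obtain t where "t \<in> {0<..<min e 1} - (\<Union>i\<in>I. {t. poly (p i) t = 0})"
    using infinite_imp_nonempty by blast
  then have t: "0 < t" "t < e" "t < 1" "\<And>i. i \<in> I \<Longrightarrow> poly (p i) t \<noteq> 0"
    by auto
  have "\<bar>h t v - w v\<bar> < e" for v
  proof -
    have "t ^ Suc (f v) \<le> t ^ 1"
      using t(1,3) by (intro power_decreasing) auto
    moreover have "\<bar>h t v - w v\<bar> = t ^ Suc (f v)"
      using t by (simp add: h_def)
    ultimately show ?thesis using t(2) by (simp del: power_Suc)
  qed
  moreover have "generic_heights V (h t)"
    unfolding generic_heights_def
  proof (intro allI ballI impI)
    fix B u assume "B \<subseteq> V" "u \<in> V - B" "affine hull B = UNIV"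
    then have "(B, u) \<in> I" by (simp add: I_def)
    then show "\<exists>l. sum l B = 1 \<and> (\<Sum>b\<in>B. l b *\<^sub>R b) = u \<and> h t u \<noteq> (\<Sum>b\<in>B. l b * h t b)"
      using L t(4)[of "(B, u)"] poly_p[of B u t] by (intro exI[of _ "L B u"]) auto
  qed
  ultimately show ?thesis by blast
qed

text \<open>Additional points are placed at one height \<open>- M\<close>, below all of the finitely
  many supporting planes.\<close>

lemma strict_cells_pad:
  fixes V :: "'a::euclidean_space set"
  assumes "finite V" "finite \<B>" "\<And>B. B \<in> \<B> \<Longrightarrow> strict_cell V w B" "card V \<le> N"
  shows "\<exists>V' w'. finite V' \<and> card V' = N \<and> (\<forall>B\<in>\<B>. strict_cell V' w' B)"
proof -
  have "infinite (UNIV - V)"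
    using \<open>finite V\<close> not_bounded_UNIV finite_imp_bounded by (intro Diff_infinite_finite) blast+
  then obtain W where W: "finite W" "card W = N - card V" "W \<subseteq> UNIV - V"
    using infinite_arbitrarily_large by blast
  have card: "card (V \<union> W) = N"
    using W assms(1,4) by (subst card_Un_disjoint) auto
  obtain z c where zc: "\<And>B v. B \<in> \<B> \<Longrightarrow> v \<in> B \<Longrightarrow> w v = z B \<bullet> v + c B"
    "\<And>B v. B \<in> \<B> \<Longrightarrow> v \<in> V - B \<Longrightarrow> w v < z B \<bullet> v + c B"
    using assms(3) unfolding strict_cell_def by metis
  have "\<forall>\<^sub>F M in at_top. - M < z B \<bullet> v + c B" for B v
    using eventually_gt_at_top[of "- (z B \<bullet> v + c B)"] by eventually_elim linarith
  then have "\<forall>\<^sub>F M in at_top. \<forall>B\<in>\<B>. \<forall>v\<in>W. - M < z B \<bullet> v + c B"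
    using assms(2) W(1) by (intro eventually_ball_finite ballI)
  then obtain M where M: "\<And>B v. B \<in> \<B> \<Longrightarrow> v \<in> W \<Longrightarrow> - M < z B \<bullet> v + c B"
    using eventually_happens'[of "at_top :: real filter"] by force
  define w' where "w' = (\<lambda>v. if v \<in> V then w v else - M)"
  have "strict_cell (V \<union> W) w' B" if "B \<in> \<B>" for B
  proof -
    have "B \<subseteq> V" using assms(3)[OF that] by (simp add: strict_cell_def)
    moreover have "w' v < z B \<bullet> v + c B" if "v \<in> V \<union> W - B" for v
      using zc(2)[OF \<open>B \<in> \<B>\<close>] M[OF \<open>B \<in> \<B>\<close>] that W(3) by (auto simp: w'_def)
    moreover have "w' v = z B \<bullet> v + c B" if "v \<in> B" for v
      using zc(1)[OF \<open>B \<in> \<B>\<close> that] \<open>B \<subseteq> V\<close> that by (auto simp: w'_def)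
    ultimately show ?thesis
      using assms(3)[OF that] unfolding strict_cell_def by blast
  qed
  then show ?thesis
    using card W(1) \<open>finite V\<close> by (intro exI[of _ "V \<union> W"] exI[of _ w']) auto
qed

text \<open>A contact point outside an affine basis \<open>B\<close> of the contact set would have
  the height interpolated from \<open>B\<close>, which genericity forbids.\<close>

lemma generic_upper_cell_simplex:
  fixes V :: "'a::euclidean_space set"
  assumes "generic_heights V w" "upper_plane V w z c"
  shows "\<not> affine_dependent (contact_set V w z c)"
proof -
  let ?A = "contact_set V w z c"
  obtain B where B: "B \<subseteq> ?A" "\<not> affine_dependent B" "affine hull ?A = affine hull B"
    using affine_basis_exists by blast
  have "affine hull B = UNIV"
    using assms(2) B(3) aff_dim_eq_full[of ?A] by (simp add: upper_plane_def)
  have "u \<in> B" if u: "u \<in> ?A" for u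
  proof (rule ccontr)
    assume "u \<notin> B"
    then obtain l where l: "sum l B = 1" "(\<Sum>b\<in>B. l b *\<^sub>R b) = u" "w u \<noteq> (\<Sum>b\<in>B. l b * w b)"
      using assms(1) u B(1) \<open>affine hull B = UNIV\<close>
      unfolding generic_heights_def contact_set_def by blast
    have "(\<Sum>b\<in>B. l b * w b) = (\<Sum>b\<in>B. l b * (z \<bullet> b + c))"
      using B(1) by (intro sum.cong) (auto simp: contact_set_def)
    also have "\<dots> = z \<bullet> (\<Sum>b\<in>B. l b *\<^sub>R b) + c * sum l B"
      by (simp add: inner_sum_right sum.distrib distrib_left sum_distrib_left mult.commute)
    also have "\<dots> = w u"
      using u l(1,2) by (simp add: contact_set_def)
    finally show False using l(3) by simp
  qed
  then show ?thesis using B(1,2) by (metis subset_antisym subsetI)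
qed

proposition strict_cells_extend_to_regular_triangulation:
  fixes V :: "'a::euclidean_space set"
  assumes "finite V" "finite \<B>" "\<B> \<noteq> {}" "\<And>B. B \<in> \<B> \<Longrightarrow> strict_cell V w B"
    and "card V \<le> N" "N \<ge> DIM('a) + 2"
  obtains V' \<T> where "finite V'" "card V' = N" "aff_dim (convex hull V') = int DIM('a)"
    "triangulation_of \<T> V'" "regular_subdivision_of \<T> V'" "finite \<T>"
    "\<And>B. B \<in> \<B> \<Longrightarrow> convex hull B \<in> \<T>" "\<And>B. B \<in> \<B> \<Longrightarrow> \<not> affine_dependent B"
proof -
  \<comment> \<open>Padding comes before perturbation, so that the heights are generic on the final
    point set.\<close>
  obtain V' w1 where V': "finite V'" "card V' = N"
    and w1: "\<And>B. B \<in> \<B> \<Longrightarrow> strict_cell V' w1 B"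
    using strict_cells_pad[OF assms(1,2,4,5)] by blast
  obtain e where "e > 0"
    and e: "\<And>w'. (\<forall>v\<in>V'. \<bar>w' v - w1 v\<bar> < e) \<Longrightarrow> (\<forall>B\<in>\<B>. strict_cell V' w' B)"
    using strict_cells_open[OF V'(1) assms(2) w1] by blast
  obtain w' where "\<forall>v\<in>V'. \<bar>w' v - w1 v\<bar> < e" and generic: "generic_heights V' w'"
    using exists_generic_heights[OF V'(1) \<open>e > 0\<close>] by blast
  then have strict: "strict_cell V' w' B" if "B \<in> \<B>" for B
    using e that by blast
  obtain B where "B \<in> \<B>" using \<open>\<B> \<noteq> {}\<close> by blast
  note B = strict[OF this]
  have "B \<subseteq> V'" "card B = Suc DIM('a)" using B by (auto simp: strict_cell_def)
  obtain z c where zc: "\<And>v. v \<in> B \<Longrightarrow> w' v = z \<bullet> v + c" "\<And>v. v \<in> V' - B \<Longrightarrow> w' v < z \<bullet> v + c"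
    using B unfolding strict_cell_def by blast
  \<comment> \<open>The bound \<open>N \<ge> DIM('a) + 2\<close> gives a point outside
    \<open>B\<close>; it lies strictly below the plane of \<open>B\<close>, so the lifted polytope
    is full-dimensional.\<close>
  have "V' - B \<noteq> {}"
    using \<open>card B = _\<close> V' assms(6) \<open>B \<subseteq> V'\<close> by (metis Diff_eq_empty_iff Suc_n_not_le_n add_2_eq_Suc' subset_antisym)
  then obtain v where v: "v \<in> V' - B" by blast
  let ?lift = "\<lambda>p. (p, w' p)"
  have lift_B: "?lift ` B = (\<lambda>x. (x, z \<bullet> x + c)) ` B"
    using zc(1) by auto
  have "affine {y. (- z, 1) \<bullet> y = c}"
    by (rule affine_hyperplane)
  then have "affine hull (?lift ` B) \<subseteq> {y. (- z, 1) \<bullet> y = c}"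
    using zc(1) by (intro hull_minimal) auto
  moreover have "?lift v \<notin> {y. (- z, 1) \<bullet> y = c}"
    using zc(2)[OF v] by auto
  ultimately have "?lift v \<notin> affine hull (?lift ` B)" by blast
  moreover have "aff_dim (?lift ` B) = int DIM('a)"
    unfolding lift_B aff_dim_graph by (rule strict_cell_affine_independent(2)[OF B])
  ultimately have "aff_dim (insert (?lift v) (?lift ` B)) = int DIM('a) + 1"
    by (simp add: aff_dim_insert)
  moreover have "insert (?lift v) (?lift ` B) \<subseteq> ?lift ` V'"
    using v \<open>B \<subseteq> V'\<close> by blast
  ultimately have "aff_dim (?lift ` V') \<ge> int DIM('a) + 1"
    by (metis aff_dim_subset)
  then have full: "aff_dim (?lift ` V') = int DIM('a) + 1"
    using aff_dim_le_DIM[of "?lift ` V'"] by simp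
  let ?T = "upper_cells V' w'"
  have regular: "regular_subdivision_of ?T V'"
    by (rule regular_subdivision_upper_cells[OF V'(1) full])
  have "int DIM('a) simplex C" if C: "C \<in> ?T" for C
  proof -
    obtain z c where "C = convex hull contact_set V' w' z c" and plane: "upper_plane V' w' z c"
      using C unfolding upper_cells_def by blast
    moreover note generic_upper_cell_simplex[OF generic plane]
    ultimately show ?thesis
      unfolding simplex_def
      using affine_independent_iff_card[of "contact_set V' w' z c"] plane
      by (intro exI[of _ "contact_set V' w' z c"]) (auto simp: upper_plane_def)
  qed
  then have "triangulation_of ?T V'"
    using regular by (auto simp: triangulation_of_def regular_subdivision_of_def)
  moreover have "finite ?T"
    using V'(1) by (rule_tac finite_subset[of _ "(\<lambda>S. convex hull S) ` Pow V'"])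
      (auto simp: upper_cells_def contact_set_def)
  moreover have "convex hull B \<in> ?T" if B: "B \<in> \<B>" for B
  proof -
    obtain z c where "upper_plane V' w' z c" "contact_set V' w' z c = B"
      using strict_cell_upper_plane[OF strict[OF B]] .
    then show ?thesis unfolding upper_cells_def by blast
  qed
  moreover have "aff_dim (convex hull V') = int DIM('a)"
    using aff_dim_subset[OF \<open>B \<subseteq> V'\<close>] strict_cell_affine_independent(2)[OF B] aff_dim_le_DIM[of V']
    by (simp add: aff_dim_convex_hull)
  moreover have "\<not> affine_dependent B" if "B \<in> \<B>" for B
    by (rule strict_cell_affine_independent(1)[OF strict[OF that]])
  ultimately show ?thesis
    by (intro that[OF V' _ _ regular]) auto
qed

section \<open>Indexed vertex sets and gluing across a hyperplane\<close>

lemma interpolable_family: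
  fixes y :: "nat \<Rightarrow> 'a::euclidean_space"
  assumes "\<And>r. \<exists>z c. \<forall>k\<le>n. z \<bullet> y k + c = r k"
  shows "interpolable (y ` {..n})" "card (y ` {..n}) = Suc n"
proof -
  show "interpolable (y ` {..n})"
    unfolding interpolable_def
  proof
    fix r :: "'a \<Rightarrow> real"
    show "\<exists>z c. \<forall>x\<in>y ` {..n}. z \<bullet> x + c = r x"
      using assms[of "r \<circ> y"] by auto
  qed
  \<comment> \<open>An affine function with value \<open>k\<close> at \<open>y k\<close> shows that
    the points are distinct.\<close>
  obtain z c where zc: "\<forall>k\<le>n. z \<bullet> y k + c = real k"
    using assms[of real] by blast
  have "inj_on y {..n}"
    using zc by (intro inj_onI) (metis atMost_iff of_nat_eq_iff)
  then show "card (y ` {..n}) = Suc n"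
    by (simp add: card_image)
qed

text \<open>Subtracting \<open>M * (n \<bullet> v - h)\<close> on \<open>V2\<close> alone bends the
  heights concavely along the separating hyperplane. An affine change preserves the cells within
  \<open>V2\<close>, and for large \<open>M\<close> each side lies below the supporting planes of
  the other.\<close>

lemma strict_cells_glue:
  fixes V1 V2 :: "'a::euclidean_space set"
  assumes "finite V1" "finite V2" "finite \<B>1" "finite \<B>2"
    and strict1: "\<And>B. B \<in> \<B>1 \<Longrightarrow> strict_cell V1 w1 B"
    and strict2: "\<And>B. B \<in> \<B>2 \<Longrightarrow> strict_cell V2 w2 B"
    and sep: "\<And>x. x \<in> V1 \<Longrightarrow> n \<bullet> x < h" "\<And>x. x \<in> V2 \<Longrightarrow> h < n \<bullet> x"
  shows "\<exists>w. \<forall>B\<in>\<B>1 \<union> \<B>2. strict_cell (V1 \<union> V2) w B"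
proof -
  obtain z c where zc: "\<And>B v. B \<in> \<B>1 \<Longrightarrow> v \<in> B \<Longrightarrow> w1 v = z B \<bullet> v + c B"
    "\<And>B v. B \<in> \<B>1 \<Longrightarrow> v \<in> V1 - B \<Longrightarrow> w1 v < z B \<bullet> v + c B"
    using strict1 unfolding strict_cell_def by metis
  obtain z' c' where zc': "\<And>B v. B \<in> \<B>2 \<Longrightarrow> v \<in> B \<Longrightarrow> w2 v = z' B \<bullet> v + c' B"
    "\<And>B v. B \<in> \<B>2 \<Longrightarrow> v \<in> V2 - B \<Longrightarrow> w2 v < z' B \<bullet> v + c' B"
    using strict2 unfolding strict_cell_def by metis
  have large: "\<forall>\<^sub>F M in at_top. \<forall>B\<in>\<B>. \<forall>v\<in>V. f B v < M * g v"
    if "finite V" "finite \<B>" "\<And>v. v \<in> V \<Longrightarrow> g v > 0"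
    for V :: "'a set" and \<B> :: "'a set set" and f :: "'a set \<Rightarrow> 'a \<Rightarrow> real" and g
  proof (intro eventually_ball_finite ballI that(1,2))
    fix B v assume "v \<in> V"
    show "\<forall>\<^sub>F M in at_top. f B v < M * g v"
      using eventually_gt_at_top[of "f B v / g v"]
      by eventually_elim (simp add: that(3)[OF \<open>v \<in> V\<close>] pos_divide_less_eq)
  qed
  have "\<forall>\<^sub>F M in at_top. (\<forall>B\<in>\<B>1. \<forall>v\<in>V2. w2 v - (z B \<bullet> v + c B) < M * (n \<bullet> v - h)) \<and>
      (\<forall>B\<in>\<B>2. \<forall>v\<in>V1. w1 v - (z' B \<bullet> v + c' B) < M * (h - n \<bullet> v))"
    using assms by (intro eventually_conj large) auto
  then obtain M where M:
    "\<And>B v. B \<in> \<B>1 \<Longrightarrow> v \<in> V2 \<Longrightarrow> w2 v - (z B \<bullet> v + c B) < M * (n \<bullet> v - h)"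
    "\<And>B v. B \<in> \<B>2 \<Longrightarrow> v \<in> V1 \<Longrightarrow> w1 v - (z' B \<bullet> v + c' B) < M * (h - n \<bullet> v)"
    using eventually_happens'[of "at_top :: real filter"] by force
  define w where "w = (\<lambda>v. if v \<in> V1 then w1 v else w2 v - M * (n \<bullet> v - h))"
  have w2: "w v = w2 v - M * (n \<bullet> v - h)" if "v \<in> V2" for v
    using that sep by (force simp: w_def)
  have "strict_cell (V1 \<union> V2) w B" if B: "B \<in> \<B>1" for B
  proof -
    have "B \<subseteq> V1" using strict1[OF B] by (simp add: strict_cell_def)
    then have "w v = z B \<bullet> v + c B" if "v \<in> B" for v
      using zc(1)[OF B that] that by (auto simp: w_def)
    moreover have "w v < z B \<bullet> v + c B" if v: "v \<in> V1 \<union> V2 - B" for v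
    proof (cases "v \<in> V1")
      case True
      then show ?thesis using v zc(2)[OF B] by (simp add: w_def)
    next
      case False
      then show ?thesis using v M(1)[OF B, of v] w2[of v] by auto
    qed
    ultimately show ?thesis
      using strict1[OF B] unfolding strict_cell_def by blast
  qed
  moreover have "strict_cell (V1 \<union> V2) w B" if B: "B \<in> \<B>2" for B
  proof -
    \<comment> \<open>The plane of \<open>B\<close> is tilted along with \<open>V2\<close>; over
      \<open>V1\<close>, where \<open>n \<bullet> v < h\<close>, the tilt raises it.\<close>
    have eq: "(z' B - M *\<^sub>R n) \<bullet> v + (c' B + M * h) = z' B \<bullet> v + c' B - M * (n \<bullet> v - h)" for v
      by (simp add: algebra_simps)
    have "B \<subseteq> V2" using strict2[OF B] by (simp add: strict_cell_def)
    then have "w v = (z' B - M *\<^sub>R n) \<bullet> v + (c' B + M * h)" if "v \<in> B" for v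
      using zc'(1)[OF B that] that w2[of v] eq[of v] by auto
    moreover have "w v < (z' B - M *\<^sub>R n) \<bullet> v + (c' B + M * h)" if v: "v \<in> V1 \<union> V2 - B" for v
    proof (cases "v \<in> V1")
      case True
      then show ?thesis using M(2)[OF B True] eq[of v] by (simp add: w_def algebra_simps)
    next
      case False
      then show ?thesis using v zc'(2)[OF B, of v] w2[of v] eq[of v] by auto
    qed
    ultimately show ?thesis
      using strict2[OF B] unfolding strict_cell_def by blast
  qed
  ultimately show ?thesis by blast
qed

subsection \<open>A fan whose cells all meet the same rays\<close>

text \<open>Dual form of the linear independence of \<open>c 0, ..., c (DIM('a) - 1)\<close>, which
  span the cone of rays to be met.\<close>

locale zigzag_fan =
  fixes c :: "nat \<Rightarrow> 'a::euclidean_space"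
  assumes free: "\<And>r. \<exists>z. \<forall>k<DIM('a). z \<bullet> c k = r k"
begin

text \<open>A point of the hyperplane through the \<open>c k\<close>. Seen from it, points of the
  cone in this hyperplane have coordinates in \<open>[1, 2]\<close> along the differences
  \<open>c (Suc k) - c 0\<close>, the range that the recursion for \<open>\<nu>\<close>
  needs.\<close>

definition apex :: 'a
  where "apex = c 0 - (\<Sum>k<DIM('a) - 1. c (Suc k) - c 0)"

text \<open>All vectors but the last are parallel to the hyperplane through the \<open>c k\<close>.
  The last is transversal, and its factor keeps the points of the fan on the far side of a parallel
  hyperplane.\<close>

definition frame :: "nat \<Rightarrow> 'a"
  where "frame k = (if k = DIM('a) - 1 then (1 / (4 * DIM('a))) *\<^sub>R apex else c (Suc k) - c 0)"

definition prev :: "nat \<Rightarrow> 'a"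
  where "prev k = (if k = 0 then 0 else frame (k - 1))"

definition edge :: "nat \<Rightarrow> real \<Rightarrow> 'a"
  where "edge k e = e *\<^sub>R frame k + 3 *\<^sub>R prev k"

text \<open>The factor \<open>2 * DIM('a)\<close> makes each barycentric coordinate of the stabbing
  point at most \<open>1 / DIM('a)\<close>, so that they sum to at most 1.\<close>

definition pt :: "nat \<Rightarrow> real \<Rightarrow> 'a"
  where "pt k e = apex + (2 * DIM('a)) *\<^sub>R edge k e"

definition sg :: "nat set \<Rightarrow> nat \<Rightarrow> real"
  where "sg S k = (if k \<in> S then - 1 else 1)"

text \<open>The point \<open>pt 0 (-1)\<close> is left out, which brings a fan down to \<open>2 d\<close> points.\<close>

definition pts :: "'a set"
  where "pts = insert apex (insert (pt 0 1) ((\<lambda>(k, e). pt k e) ` ({1..<DIM('a)} \<times> {1, - 1})))"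

definition cell :: "nat set \<Rightarrow> 'a set"
  where "cell S = insert apex ((\<lambda>k. pt k (sg S k)) ` {..<DIM('a)})"

lemma sg_simps [simp]: "sg S k * sg S k = 1" "sg S k * (sg S k * x) = x" "\<bar>sg S k\<bar> = 1"
  by (auto simp: sg_def)

lemma sg_0: "S \<in> Pow {1..<DIM('a)} \<Longrightarrow> sg S 0 = 1"
  by (auto simp: sg_def)

lemma finite_pts: "finite pts"
  by (simp add: pts_def)

lemma card_pts: "card pts \<le> 2 * DIM('a)"
proof -
  let ?A = "(\<lambda>(k, e). pt k e) ` ({1..<DIM('a)} \<times> {1, - 1})"
  have "card ?A \<le> card ({1..<DIM('a)} \<times> {1, - 1 :: real})"
    by (intro card_image_le) auto
  then have "card ?A \<le> (DIM('a) - 1) * 2"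
    by (simp add: card_cartesian_product)
  moreover have "card pts \<le> Suc (Suc (card ?A))"
    unfolding pts_def by (auto simp: card_insert_if)
  ultimately show ?thesis
    using DIM_positive[where 'a='a] by linarith
qed

lemma cell_subset_pts: "S \<in> Pow {1..<DIM('a)} \<Longrightarrow> cell S \<subseteq> pts"
proof -
  assume S: "S \<in> Pow {1..<DIM('a)}"
  have "pt k (sg S k) \<in> pts" if "k < DIM('a)" for k
  proof (cases "k = 0")
    case True
    then show ?thesis using sg_0[OF S] by (simp add: pts_def)
  next
    case False
    then have "(k, sg S k) \<in> {1..<DIM('a)} \<times> {1, - 1}"
      using that by (auto simp: sg_def)
    then show ?thesis unfolding pts_def by force
  qed
  then show ?thesis by (auto simp: cell_def pts_def)
qed

lemma frame_free: "\<exists>z. \<forall>k<DIM('a). z \<bullet> frame k = r k"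
proof -
  \<comment> \<open>This value at \<open>c 0\<close> forces
    \<open>z \<bullet> apex = 4 * DIM('a) * r (DIM('a) - 1)\<close>, the value required by the last
    frame vector.\<close>
  define g where "g = 4 * DIM('a) * r (DIM('a) - 1) + (\<Sum>k<DIM('a) - 1. r k)"
  obtain z where z: "\<And>k. k < DIM('a) \<Longrightarrow> z \<bullet> c k = (case k of 0 \<Rightarrow> g | Suc j \<Rightarrow> g + r j)"
    using free by meson
  have 0: "z \<bullet> c 0 = g"
    using z[of 0] DIM_positive by simp
  have Suc: "z \<bullet> c (Suc k) = g + r k" if "k < DIM('a) - 1" for k
    using z[of "Suc k"] that by simp
  have "z \<bullet> apex = g - (\<Sum>k<DIM('a) - 1. r k)"
    using 0 Suc by (simp add: apex_def inner_diff_right inner_sum_right del: sum_subtractf)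
  then have "z \<bullet> apex = 4 * DIM('a) * r (DIM('a) - 1)"
    by (simp add: g_def)
  then have "z \<bullet> frame k = r k" if "k < DIM('a)" for k
    using 0 Suc[of k] that DIM_positive[where 'a='a] by (auto simp: frame_def inner_diff_right)
  then show ?thesis by blast
qed

text \<open>The edges are bidiagonal in the frame with diagonal entries \<plusminus>1, so the values
  on the frame follow by forward substitution; each sign is its own inverse.\<close>

lemma edge_free: "\<exists>z. \<forall>k<DIM('a). z \<bullet> edge k (sg S k) = r k"
proof -
  define q where "q = rec_nat (sg S 0 * r 0) (\<lambda>k x. sg S (Suc k) * (r (Suc k) - 3 * x))"
  obtain z where z: "\<And>k. k < DIM('a) \<Longrightarrow> z \<bullet> frame k = q k"
    using frame_free by meson
  have "z \<bullet> edge k (sg S k) = r k" if "k < DIM('a)" for k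
    using that z by (cases k) (simp_all add: edge_def prev_def inner_add_right q_def)
  then show ?thesis by blast
qed

lemma cell_interpolable: "interpolable (cell S)" "card (cell S) = Suc DIM('a)"
proof -
  let ?y = "\<lambda>k. if k = DIM('a) then apex else pt k (sg S k)"
  have "\<exists>z c. \<forall>k\<le>DIM('a). z \<bullet> ?y k + c = r k" for r
  proof -
    obtain z where z: "\<And>k. k < DIM('a) \<Longrightarrow>
        z \<bullet> edge k (sg S k) = (r k - r DIM('a)) / (2 * DIM('a))"
      using edge_free[of S "\<lambda>k. (r k - r DIM('a)) / (2 * DIM('a))"] by blast
    have "z \<bullet> ?y k + (r DIM('a) - z \<bullet> apex) = r k" if "k \<le> DIM('a)" for k
      using z[of k] that by (auto simp: pt_def inner_add_right)
    then show ?thesis by blast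
  qed
  note y = interpolable_family[of "DIM('a)" ?y, OF this]
  have "?y ` {..DIM('a)} = cell S"
    by (auto simp: cell_def image_iff)
  then show "interpolable (cell S)" "card (cell S) = Suc DIM('a)"
    using y by simp_all
qed

section \<open>Heights over a fan\<close>

definition slope :: "nat set \<Rightarrow> 'a"
  where "slope S = (SOME z. \<forall>k<DIM('a). z \<bullet> edge k (sg S k) = - (10 ^ k))"

definition height :: "nat set \<Rightarrow> 'a \<Rightarrow> real"
  where "height S x = slope S \<bullet> (x - apex)"

text \<open>Taking the minimum of the height functions avoids proving that the points are distinct.\<close>

definition roof :: "'a \<Rightarrow> real"
  where "roof x = Min ((\<lambda>S. height S x) ` Pow {1..<DIM('a)})"

lemma slope_edge: "k < DIM('a) \<Longrightarrow> slope S \<bullet> edge k (sg S k) = - (10 ^ k)"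
  using someI_ex[OF edge_free[of S "\<lambda>k. - (10 ^ k)"]] by (simp add: slope_def)

text \<open>The induction closes because
  \<open>10 ^ Suc k + 3 * (2 * 10 ^ k) \<le> 2 * 10 ^ Suc k\<close>.\<close>

lemma slope_frame_bound: "k < DIM('a) \<Longrightarrow> \<bar>slope S \<bullet> frame k\<bar> \<le> 2 * 10 ^ k"
proof (induction k)
  case 0
  then show ?case
    using slope_edge[of 0 S] by (auto simp: edge_def prev_def sg_def split: if_splits)
next
  case (Suc k)
  then have "\<bar>slope S \<bullet> frame k\<bar> \<le> 2 * 10 ^ k" by simp
  then show ?case
    using slope_edge[OF Suc.prems, of S]
    by (auto simp: edge_def prev_def sg_def inner_add_right split: if_splits)
qed

lemma height_apex: "height S apex = 0"
  by (simp add: height_def)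

lemma height_pt: "height S (pt k e) = 2 * DIM('a) * (slope S \<bullet> edge k e)"
  by (simp add: height_def pt_def)

lemma height_pt_cell: "k < DIM('a) \<Longrightarrow> height S (pt k (sg S k)) = - (2 * real DIM('a) * 10 ^ k)"
  by (simp add: height_pt slope_edge)

text \<open>Flipping the sign at \<open>k = Suc j\<close> turns the slope along the edge from
  \<open>- (10 * 10 ^ j)\<close> into \<open>10 * 10 ^ j\<close> plus six times the slope along
  \<open>frame j\<close>. By the preceding bound this is at least \<open>- 2 * 10 ^ j\<close>, hence
  larger.\<close>

lemma height_pt_other:
  assumes "k \<in> {1..<DIM('a)}" "sg S k = - e"
  shows "- (2 * real DIM('a) * 10 ^ k) < height S (pt k e)"
proof -
  obtain j where j: "k = Suc j" "Suc j < DIM('a)"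
    using assms(1) by (cases k) auto
  have "\<bar>slope S \<bullet> frame j\<bar> \<le> 2 * 10 ^ j"
    using slope_frame_bound j by simp
  moreover have "- e * (slope S \<bullet> frame k) + 3 * (slope S \<bullet> frame j) = - (10 * 10 ^ j)"
    using slope_edge[of k S] j assms by (simp add: edge_def prev_def inner_add_right)
  moreover have "slope S \<bullet> edge k e = e * (slope S \<bullet> frame k) + 3 * (slope S \<bullet> frame j)"
    using j by (simp add: edge_def prev_def inner_add_right)
  moreover have "(10::real) ^ j > 0" by simp
  ultimately have "- (10 * 10 ^ j) < slope S \<bullet> edge k e"
    by linarith
  then have "- (10 ^ k) < slope S \<bullet> edge k e"
    using j by simp
  then have "2 * real DIM('a) * - (10 ^ k) < 2 * real DIM('a) * (slope S \<bullet> edge k e)"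
    by (intro mult_strict_left_mono) simp_all
  then show ?thesis by (simp add: height_pt)
qed

lemma roof_le: "S \<in> Pow {1..<DIM('a)} \<Longrightarrow> roof x \<le> height S x"
  unfolding roof_def by (intro Min_le) auto

text \<open>At a vertex of \<open>cell S\<close>, every other height function agrees with
  \<open>height S\<close> if its sign matches there and exceeds it otherwise.\<close>

lemma roof_cell:
  assumes "S \<in> Pow {1..<DIM('a)}" "x \<in> cell S"
  shows "roof x = height S x"
proof -
  have "height S x \<le> height S' x" if S': "S' \<in> Pow {1..<DIM('a)}" for S'
  proof (cases "x = apex")
    case True
    then show ?thesis by (simp add: height_apex)
  next
    case False
    then obtain k where k: "k < DIM('a)" "x = pt k (sg S k)"
      using assms(2) by (auto simp: cell_def)
    show ?thesis
    proof (cases "sg S' k = sg S k")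
      case True
      then show ?thesis using k height_pt_cell[of k S] height_pt_cell[of k S'] by simp
    next
      case False
      then have "k \<noteq> 0" using sg_0 assms(1) S' by metis
      moreover have "sg S' k = - sg S k" using False by (auto simp: sg_def split: if_splits)
      ultimately show ?thesis
        using height_pt_other[of k S' "sg S k"] height_pt_cell[of k S] k by simp
    qed
  qed
  then show ?thesis
    unfolding roof_def using assms(1) by (intro Min_eqI) auto
qed

lemma roof_other:
  assumes "k \<in> {1..<DIM('a)}" "e \<in> {1, - 1}" "sg S k \<noteq> e"
  shows "roof (pt k e) < height S (pt k e)"
proof -
  \<comment> \<open>Any sign pattern with value \<open>e\<close> at \<open>k\<close> would serve;
    this is the smallest one.\<close>
  define S' where "S' = (if e = 1 then {} else {k})"
  have S': "S' \<in> Pow {1..<DIM('a)}" "sg S' k = e"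
    using assms by (auto simp: S'_def sg_def)
  then have "roof (pt k e) \<le> - (2 * real DIM('a) * 10 ^ k)"
    using roof_le[OF S'(1), of "pt k e"] height_pt_cell[of k S'] assms(1) by simp
  also have "sg S k = - e"
    using assms(2,3) by (auto simp: sg_def split: if_splits)
  then have "- (2 * real DIM('a) * 10 ^ k) < height S (pt k e)"
    using height_pt_other assms(1) by blast
  finally show ?thesis .
qed

lemma strict_cell_fan:
  assumes "S \<in> Pow {1..<DIM('a)}"
  shows "strict_cell pts roof (cell S)"
proof -
  have height: "height S x = slope S \<bullet> x + (- (slope S \<bullet> apex))" for x
    by (simp add: height_def inner_diff_right)
  have "roof x < height S x" if x: "x \<in> pts - cell S" for x
  proof -
    have "pt 0 1 \<in> cell S"
      using sg_0[OF assms] image_eqI[of "pt 0 1" "\<lambda>k. pt k (sg S k)" 0 "{..<DIM('a)}"]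
      by (simp add: cell_def)
    moreover have "apex \<in> cell S" by (simp add: cell_def)
    ultimately have "x \<in> (\<lambda>(k, e). pt k e) ` ({1..<DIM('a)} \<times> {1, - 1})"
      using x by (metis DiffE insertE pts_def)
    then obtain y where y: "x = (\<lambda>(k, e). pt k e) y" "y \<in> {1..<DIM('a)} \<times> {1, - 1}"
      by (rule imageE)
    obtain k e where "y = (k, e)"
      by (cases y)
    then have k: "k \<in> {1..<DIM('a)}" "e \<in> {1, - 1}" "x = pt k e"
      using y by simp_all
    moreover have "sg S k \<noteq> e"
      using k x by (auto simp: cell_def)
    ultimately show ?thesis using roof_other by blast
  qed
  then show ?thesis
    unfolding strict_cell_def
    using roof_cell[OF assms] cell_interpolable cell_subset_pts[OF assms] height by metis
qed

text \<open>If the signs differ at \<open>k\<close>, the vertex of \<open>cell S\<close> there is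
  strictly below the plane of \<open>cell S'\<close> and thus not one of its vertices.\<close>

lemma inj_on_cell: "inj_on cell (Pow {1..<DIM('a)})"
proof (rule inj_onI, rule ccontr)
  fix S S' assume S: "S \<in> Pow {1..<DIM('a)}" "S' \<in> Pow {1..<DIM('a)}" "cell S = cell S'" "S \<noteq> S'"
  then obtain k where "(k \<in> S) \<noteq> (k \<in> S')"
    by blast
  then have k: "k \<in> {1..<DIM('a)}" "sg S k \<noteq> sg S' k"
    using S(1,2) by (auto simp: sg_def)
  have "pt k (sg S k) \<in> cell S'"
    using S(3) k(1) by (auto simp: cell_def)
  then have "roof (pt k (sg S k)) = height S' (pt k (sg S k))"
    using roof_cell S(2) by blast
  moreover have "sg S k \<in> {1, - 1}" by (simp add: sg_def)
  ultimately show False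
    using roof_other[OF k(1), of "sg S k" S'] k(2) by force
qed

lemma card_cells: "card (cell ` Pow {1..<DIM('a)}) = 2 ^ (DIM('a) - 1)"
  using inj_on_cell by (simp add: card_image card_Pow)

text \<open>The functional \<open>n\<close> is \<open>h\<close> at the apex and 0 on all frame
  vectors but the last, which contributes at most
  \<open>2 * DIM('a) * h / (4 * DIM('a)) = h / 2\<close> in absolute value.\<close>

lemma pts_beyond:
  assumes n: "\<And>k. k < DIM('a) \<Longrightarrow> n \<bullet> c k = h" and "h > 0" "x \<in> pts"
  shows "n \<bullet> x \<ge> h / 2"
proof -
  have "n \<bullet> apex = n \<bullet> c 0 - (\<Sum>k<DIM('a) - 1. n \<bullet> c (Suc k) - n \<bullet> c 0)"
    by (simp add: apex_def inner_diff_right inner_sum_right)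
  also have "\<dots> = h - (\<Sum>k<DIM('a) - 1. 0)"
    using n DIM_positive[where 'a='a] by (intro arg_cong2[where f = minus] sum.cong) auto
  finally have apex: "n \<bullet> apex = h" by simp
  have frame: "n \<bullet> frame k = 0" if "k < DIM('a) - 1" for k
    using that n[of "Suc k"] n[of 0] by (simp add: frame_def inner_diff_right)
  have last: "n \<bullet> frame (DIM('a) - 1) = h / (4 * DIM('a))"
    by (simp add: frame_def apex)
  have pt: "n \<bullet> pt k e \<ge> h / 2" if "k < DIM('a)" "e \<in> {1, - 1}" for k e
  proof -
    have "n \<bullet> prev k = 0"
      using that frame[of "k - 1"] by (auto simp: prev_def)
    then have "n \<bullet> pt k e = h + 2 * DIM('a) * (e * (n \<bullet> frame k))"
      by (simp add: pt_def edge_def inner_add_right apex)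
    moreover have "2 * DIM('a) * (e * (n \<bullet> frame k)) \<ge> - (h / 2)"
    proof (cases "k = DIM('a) - 1")
      case True
      then have "2 * DIM('a) * (e * (n \<bullet> frame k)) = e * (h / 2)"
        using last by simp
      then show ?thesis using that(2) \<open>h > 0\<close> by auto
    next
      case False
      then show ?thesis using frame[of k] that(1) \<open>h > 0\<close> by simp
    qed
    ultimately show ?thesis by simp
  qed
  show ?thesis
    using \<open>x \<in> pts\<close> apex \<open>h > 0\<close> pt by (auto simp: pts_def)
qed

lemma cell_meets_ray:
  assumes t: "\<And>k. k < DIM('a) \<Longrightarrow> 0 \<le> t k" and pos: "0 < (\<Sum>k<DIM('a). t k)"
  shows "convex hull (cell S) \<inter> ray_from 0 (\<Sum>k<DIM('a). t k *\<^sub>R c k) \<noteq> {}"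
proof -
  define m where "m = DIM('a) - 1"
  have d: "DIM('a) = Suc m" using DIM_positive[where 'a='a] by (simp add: m_def)
  define T where "T = (\<Sum>k<DIM('a). t k)"
  define u where "u = (\<Sum>k<DIM('a). t k *\<^sub>R c k)"
  \<comment> \<open>Coordinates, relative to the apex, of the point where the ray crosses the
    hyperplane through the \<open>c k\<close>.\<close>
  define y where "y = (\<lambda>k. 1 + t (Suc k) / T)"
  \<comment> \<open>Coefficients of the edges, found by comparing coefficients of the frame vectors.
    The choice \<open>\<nu> 0 = 0\<close> fixes the one degree of freedom, the position on the
    ray.\<close>
  define \<nu> where "\<nu> = rec_nat 0 (\<lambda>k x. (y k - sg S k * x) / 3)"
  have \<nu>_0: "\<nu> 0 = 0" and \<nu>_Suc: "3 * \<nu> (Suc k) = y k - sg S k * \<nu> k" for k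
    by (simp_all add: \<nu>_def)
  have "T > 0" using pos by (simp add: T_def)
  have frame: "frame k = c (Suc k) - c 0" if "k < m" for k
    using that by (simp add: frame_def d)
  have apex: "apex = c 0 - (\<Sum>k<m. frame k)"
    using frame by (simp add: apex_def d)
  have last: "frame m = (1 / (4 * DIM('a))) *\<^sub>R apex"
    by (simp add: frame_def d)
  have y: "1 \<le> y k" "y k \<le> 2" if "k < m" for k
  proof -
    have "t (Suc k) \<le> T"
      unfolding T_def using t that d by (intro member_le_sum) auto
    then show "1 \<le> y k" "y k \<le> 2"
      using t[of "Suc k"] that d \<open>T > 0\<close> by (auto simp: y_def)
  qed
  have \<nu>: "0 \<le> \<nu> k \<and> \<nu> k \<le> 1" if "k < DIM('a)" for k
    using that
  proof (induction k)
    case 0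
    then show ?case by (simp add: \<nu>_0)
  next
    case (Suc k)
    then have "\<bar>sg S k * \<nu> k\<bar> \<le> 1" "1 \<le> y k" "y k \<le> 2"
      using y[of k] d by (auto simp: abs_mult)
    \<comment> \<open>A number in \<open>[1, 2]\<close> plus or minus one in \<open>[0, 1]\<close>
      lies in \<open>[0, 3]\<close>; dividing by 3 leads back to \<open>[0, 1]\<close>.\<close>
    then show ?case using \<nu>_Suc[of k] by linarith
  qed
  have "(1 / T) *\<^sub>R u = apex + (\<Sum>k<m. y k *\<^sub>R frame k)"
  proof -
    have sumT: "t 0 = T - (\<Sum>k<m. t (Suc k))"
      unfolding T_def d sum.lessThan_Suc_shift by simp
    have "u = t 0 *\<^sub>R c 0 + (\<Sum>k<m. t (Suc k) *\<^sub>R c (Suc k))"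
      unfolding u_def d by (rule sum.lessThan_Suc_shift)
    also have "\<dots> = T *\<^sub>R c 0 + (\<Sum>k<m. t (Suc k) *\<^sub>R frame k)"
      by (simp add: sumT frame scaleR_diff_left scaleR_diff_right scaleR_sum_left sum_subtractf)
    finally have "(1 / T) *\<^sub>R u = c 0 + (\<Sum>k<m. (t (Suc k) / T) *\<^sub>R frame k)"
      using \<open>T > 0\<close> by (simp add: scaleR_add_right scaleR_sum_right)
    also have "\<dots> = apex + (\<Sum>k<m. y k *\<^sub>R frame k)"
      by (simp add: apex y_def scaleR_add_left sum.distrib)
    finally show ?thesis .
  qed
  \<comment> \<open>After shifting the \<open>prev\<close> terms, the recursion leaves exactly
    \<open>y k\<close> on \<open>frame k\<close> for \<open>k < m\<close>. The surplus on
    \<open>frame m\<close> is a multiple of the apex.\<close>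
  moreover have "(\<Sum>k<DIM('a). \<nu> k *\<^sub>R edge k (sg S k)) =
      (\<Sum>k<m. y k *\<^sub>R frame k) + (\<nu> m * sg S m) *\<^sub>R frame m"
  proof -
    have "(\<Sum>k<DIM('a). \<nu> k *\<^sub>R edge k (sg S k)) =
        (\<Sum>k<Suc m. (\<nu> k * sg S k) *\<^sub>R frame k) + (\<Sum>k<Suc m. (3 * \<nu> k) *\<^sub>R prev k)"
      by (simp add: d edge_def scaleR_add_right sum.distrib mult.commute)
    also have "(\<Sum>k<Suc m. (3 * \<nu> k) *\<^sub>R prev k) = (\<Sum>k<m. (y k - sg S k * \<nu> k) *\<^sub>R frame k)"
      unfolding sum.lessThan_Suc_shift by (simp add: prev_def \<nu>_Suc)
    finally show ?thesis
      by (simp add: scaleR_diff_left sum_subtractf mult.commute)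
  qed
  ultimately have ray: "(1 / T) *\<^sub>R u = (1 - \<nu> m * sg S m / (4 * DIM('a))) *\<^sub>R apex +
      (\<Sum>k<DIM('a). \<nu> k *\<^sub>R edge k (sg S k))"
    by (simp add: last scaleR_diff_left)
  define \<kappa> where "\<kappa> = 1 - \<nu> m * sg S m / (4 * DIM('a))"
  have "\<bar>\<nu> m * sg S m / (4 * DIM('a))\<bar> \<le> 1 / 4"
  proof -
    have "\<bar>\<nu> m * sg S m\<bar> \<le> 1" using \<nu>[of m] d by (simp add: abs_mult)
    also have "1 \<le> real DIM('a)" using d by simp
    finally have "\<bar>\<nu> m * sg S m\<bar> \<le> real DIM('a)" .
    then show ?thesis by (simp add: d abs_mult divide_simps)
  qed
  then have \<kappa>: "\<kappa> \<ge> 3 / 4" unfolding \<kappa>_def by linarith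
  \<comment> \<open>Dividing by \<open>\<kappa>\<close> moves along the ray until the apex has
    coefficient 1, as needed for an affine combination.\<close>
  define x where "x = (1 / (\<kappa> * T)) *\<^sub>R u"
  have "x \<in> ray_from 0 u"
    unfolding ray_from_def x_def using \<kappa> \<open>T > 0\<close> by (auto intro!: exI[of _ "1 / (\<kappa> * T)"])
  define l where "l = (\<lambda>k. \<nu> k / (2 * DIM('a) * \<kappa>))"
  have "x = (1 / \<kappa>) *\<^sub>R ((1 / T) *\<^sub>R u)" by (simp add: x_def)
  also have "\<dots> = apex + (\<Sum>k<DIM('a). (\<nu> k / \<kappa>) *\<^sub>R edge k (sg S k))"
    unfolding ray \<kappa>_def[symmetric] using \<kappa> by (simp add: scaleR_add_right scaleR_sum_right)
  also have "(\<Sum>k<DIM('a). (\<nu> k / \<kappa>) *\<^sub>R edge k (sg S k)) = (\<Sum>k<DIM('a). l k *\<^sub>R (pt k (sg S k) - apex))"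
    by (intro sum.cong) (auto simp: l_def pt_def)
  finally have x: "x = (1 - (\<Sum>k<DIM('a). l k)) *\<^sub>R apex + (\<Sum>k<DIM('a). l k *\<^sub>R pt k (sg S k))"
    by (simp add: scaleR_diff_right scaleR_diff_left sum_subtractf scaleR_sum_left)
  have l: "0 \<le> l k" if "k < DIM('a)" for k
    using \<nu>[OF that] \<kappa> by (simp add: l_def)
  have "l k \<le> 1 / DIM('a)" if "k < DIM('a)" for k
  proof -
    have "\<nu> k \<le> 2 * \<kappa>" using \<nu>[OF that] \<kappa> by linarith
    then show ?thesis using \<kappa> by (simp add: l_def divide_simps)
  qed
  then have "(\<Sum>k<DIM('a). l k) \<le> (\<Sum>k<DIM('a). 1 / DIM('a))"
    by (intro sum_mono) auto
  then have "(\<Sum>k<DIM('a). l k) \<le> 1" by simp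
  have hull: "apex \<in> convex hull cell S" "\<And>k. k < DIM('a) \<Longrightarrow> pt k (sg S k) \<in> convex hull cell S"
    by (auto intro!: hull_inc simp: cell_def)
  \<comment> \<open>Index \<open>DIM('a)\<close> stands for the apex, which takes the remaining
    weight.\<close>
  define lam where "lam = (\<lambda>k. if k = DIM('a) then 1 - (\<Sum>k<DIM('a). l k) else l k)"
  define p where "p = (\<lambda>k. if k = DIM('a) then apex else pt k (sg S k))"
  have "(\<Sum>k\<in>{..DIM('a)}. lam k *\<^sub>R p k) \<in> convex hull cell S"
    using hull l \<open>(\<Sum>k<DIM('a). l k) \<le> 1\<close>
    by (intro convex_sum) (auto simp: lam_def p_def lessThan_Suc_atMost[symmetric])
  also have "(\<Sum>k\<in>{..DIM('a)}. lam k *\<^sub>R p k) = x"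
    unfolding x by (simp add: lam_def p_def lessThan_Suc_atMost[symmetric])
  finally show ?thesis
    using \<open>x \<in> ray_from 0 u\<close> unfolding u_def by blast
qed

end

proposition exists_zigzag_fan:
  fixes c :: "nat \<Rightarrow> 'a::euclidean_space"
  assumes "\<And>r. \<exists>z. \<forall>k<DIM('a). z \<bullet> c k = r k"
  obtains V w \<B> where "finite V" "card V \<le> 2 * DIM('a)" "finite \<B>" "card \<B> = 2 ^ (DIM('a) - 1)"
    "\<And>B. B \<in> \<B> \<Longrightarrow> strict_cell V w B"
    "\<And>n h x. (\<And>k. k < DIM('a) \<Longrightarrow> n \<bullet> c k = h) \<Longrightarrow> h > 0 \<Longrightarrow> x \<in> V \<Longrightarrow> n \<bullet> x \<ge> h / 2"
    "\<And>B t. B \<in> \<B> \<Longrightarrow> (\<And>k. k < DIM('a) \<Longrightarrow> 0 \<le> t k) \<Longrightarrow> 0 < (\<Sum>k<DIM('a). t k) \<Longrightarrow>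
      convex hull B \<inter> ray_from 0 (\<Sum>k<DIM('a). t k *\<^sub>R c k) \<noteq> {}"
proof -
  interpret zigzag_fan c
    using assms by unfold_locales
  show ?thesis
  proof (rule that[OF finite_pts card_pts _ card_cells])
    show "finite (cell ` Pow {1..<DIM('a)})" by simp
    show "strict_cell pts roof B" if "B \<in> cell ` Pow {1..<DIM('a)}" for B
      using that strict_cell_fan by blast
    show "n \<bullet> x \<ge> h / 2" if "\<And>k. k < DIM('a) \<Longrightarrow> n \<bullet> c k = h" "h > 0" "x \<in> pts" for n h x
      by (rule pts_beyond[OF that])
    show "convex hull B \<inter> ray_from 0 (\<Sum>k<DIM('a). t k *\<^sub>R c k) \<noteq> {}"
      if B: "B \<in> cell ` Pow {1..<DIM('a)}"
        and t: "\<And>k. k < DIM('a) \<Longrightarrow> 0 \<le> t k" "0 < (\<Sum>k<DIM('a). t k)" for B t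
    proof -
      obtain S where "B = cell S" using B by blast
      then show ?thesis using cell_meets_ray[OF t] by simp
    qed
  qed
qed

subsection \<open>Surrounding a simplex by fans\<close>

definition skip :: "nat \<Rightarrow> nat \<Rightarrow> nat"
  where "skip i k = (if k < i then k else Suc k)"

lemma bij_betw_skip: "i \<le> d \<Longrightarrow> bij_betw (skip i) {..<d} ({..d} - {i})"
  by (rule bij_betw_byWitness[where f' = "\<lambda>j. if j < i then j else j - 1"])
    (auto simp: skip_def)

text \<open>The vertices of a simplex with centroid 0. The last assumption says that the cones
  spanned by all vertices but one cover the space.\<close>

locale balanced_vectors =
  fixes a :: "nat \<Rightarrow> 'a::euclidean_space"
  assumes balanced: "(\<Sum>j\<le>DIM('a). a j) = 0"
    and functional: "\<And>f. (\<Sum>j\<le>DIM('a). f j) = 0 \<Longrightarrow> \<exists>z. \<forall>j\<le>DIM('a). z \<bullet> a j = f j"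
    and positive_span: "\<And>u. \<exists>t i. (\<forall>j\<le>DIM('a). 0 \<le> t j) \<and> i \<le> DIM('a) \<and> t i = 0 \<and>
      u = (\<Sum>j\<le>DIM('a). t j *\<^sub>R a j)"
begin

lemma functional_except:
  assumes "i \<le> DIM('a)"
  shows "\<exists>z. \<forall>j\<le>DIM('a). j \<noteq> i \<longrightarrow> z \<bullet> a j = f j"
proof -
  \<comment> \<open>The free value at \<open>i\<close> is chosen to make the sum vanish.\<close>
  let ?f = "\<lambda>j. if j = i then - (\<Sum>j\<in>{..DIM('a)} - {i}. f j) else f j"
  have "(\<Sum>j\<le>DIM('a). ?f j) = ?f i + (\<Sum>j\<in>{..DIM('a)} - {i}. ?f j)"
    using assms by (intro sum.remove) auto
  also have "\<dots> = 0" by simp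
  finally obtain z where "\<forall>j\<le>DIM('a). z \<bullet> a j = ?f j"
    using functional[of ?f] by blast
  then show ?thesis by (intro exI[of _ z]) simp
qed

lemma center_interpolable: "interpolable (a ` {..DIM('a)})" "card (a ` {..DIM('a)}) = Suc DIM('a)"
proof -
  have "\<exists>z c. \<forall>k\<le>DIM('a). z \<bullet> a k + c = r k" for r
  proof -
    \<comment> \<open>Subtracting the mean makes the values sum to zero, so that a linear functional
      attains them.\<close>
    define c where "c = (\<Sum>j\<le>DIM('a). r j) / (DIM('a) + 1)"
    have "(\<Sum>j\<le>DIM('a). r j - c) = 0"
      by (simp add: sum_subtractf c_def add.commute)
    then obtain z where "\<forall>j\<le>DIM('a). z \<bullet> a j = r j - c"
      using functional[of "\<lambda>j. r j - c"] by blast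
    then show ?thesis by (intro exI[of _ z] exI[of _ c]) simp
  qed
  then show "interpolable (a ` {..DIM('a)})" "card (a ` {..DIM('a)}) = Suc DIM('a)"
    by (intro interpolable_family; blast)+
qed

lemma strict_cell_center: "strict_cell (a ` {..DIM('a)}) (\<lambda>_. 0) (a ` {..DIM('a)})"
  unfolding strict_cell_def using center_interpolable
  by (auto intro!: exI[of _ "0::'a"] exI[of _ "0::real"])

text \<open>The origin is the combination of the vertices with equal positive weights
  \<open>1 / (DIM('a) + 1)\<close>.\<close>

lemma center_interior: "0 \<in> interior (convex hull (a ` {..DIM('a)}))"
proof -
  let ?B = "a ` {..DIM('a)}"
  have inj: "inj_on a {..DIM('a)}"
    using center_interpolable(2) by (intro eq_card_imp_inj_on) auto
  have "aff_dim (convex hull ?B) = int DIM('a)"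
    using strict_cell_affine_independent(2)[OF strict_cell_center] by (simp add: aff_dim_convex_hull)
  then have "interior (convex hull ?B) = rel_interior (convex hull ?B)"
    using aff_dim_eq_full rel_interior_interior by metis
  moreover have "0 \<in> rel_interior (convex hull ?B)"
    unfolding rel_interior_convex_hull_explicit[OF strict_cell_affine_independent(1)[OF strict_cell_center]]
    using balanced center_interpolable(2)
    by (auto intro!: exI[of _ "\<lambda>_. 1 / (DIM('a) + 1)"]
        simp: sum.reindex[OF inj] scaleR_sum_right[symmetric] add.commute)
  ultimately show ?thesis by simp
qed

text \<open>Induction over the cones: the fan for the cone omitting \<open>a m\<close> is built so
  far out that a hyperplane separates it from everything placed before, and is then glued
  on.\<close>

lemma exists_surrounding_fans:
  assumes "m \<le> Suc DIM('a)"
  shows "\<exists>V w \<B>. finite V \<and> finite \<B> \<and> card V \<le> Suc DIM('a) + m * (2 * DIM('a)) \<and>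
    (\<forall>B\<in>\<B>. strict_cell V w B) \<and> a ` {..DIM('a)} \<in> \<B> \<and>
    (\<forall>i<m. \<exists>\<C>\<subseteq>\<B>. card \<C> = 2 ^ (DIM('a) - 1) \<and>
      (\<forall>B\<in>\<C>. \<forall>t. (\<forall>j\<le>DIM('a). 0 \<le> t j) \<and> t i = 0 \<and> 0 < (\<Sum>j\<le>DIM('a). t j) \<longrightarrow>
        convex hull B \<inter> ray_from 0 (\<Sum>j\<le>DIM('a). t j *\<^sub>R a j) \<noteq> {}))"
  using assms
proof (induction m)
  case 0
  show ?case
    using strict_cell_center center_interpolable(2)
    by (intro exI[of _ "a ` {..DIM('a)}"] exI[of _ "\<lambda>_. 0"] exI[of _ "{a ` {..DIM('a)}}"]) auto
next
  case (Suc m)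
  then obtain V w \<B> where V: "finite V" "finite \<B>" "card V \<le> Suc DIM('a) + m * (2 * DIM('a))"
      "\<And>B. B \<in> \<B> \<Longrightarrow> strict_cell V w B" "a ` {..DIM('a)} \<in> \<B>"
    and hit: "\<And>i. i < m \<Longrightarrow> \<exists>\<C>\<subseteq>\<B>. card \<C> = 2 ^ (DIM('a) - 1) \<and>
      (\<forall>B\<in>\<C>. \<forall>t. (\<forall>j\<le>DIM('a). 0 \<le> t j) \<and> t i = 0 \<and> 0 < (\<Sum>j\<le>DIM('a). t j) \<longrightarrow>
        convex hull B \<inter> ray_from 0 (\<Sum>j\<le>DIM('a). t j *\<^sub>R a j) \<noteq> {})"
    by auto
  have m: "m \<le> DIM('a)" using Suc.prems by simp
  note skip = bij_betw_skip[OF m]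
  have skip': "skip m k \<le> DIM('a)" "skip m k \<noteq> m" if "k < DIM('a)" for k
    using bij_betw_apply[OF skip, of k] that by auto
  obtain n where n: "\<forall>j\<le>DIM('a). j \<noteq> m \<longrightarrow> n \<bullet> a j = 2"
    using functional_except[OF m, of "\<lambda>_. 2"] by blast
  define h where "h = Max (insert 0 ((\<lambda>x. n \<bullet> x) ` V)) + 1"
  have h_gt: "n \<bullet> x < h" if "x \<in> V" for x
  proof -
    have "n \<bullet> x \<le> Max (insert 0 ((\<lambda>x. n \<bullet> x) ` V))"
      using that V(1) by (intro Max_ge) auto
    then show ?thesis by (simp add: h_def)
  qed
  have "h \<ge> 1"
    using V(1) by (simp add: h_def)
  \<comment> \<open>Since \<open>n\<close> is \<open>2 * R\<close> on the scaled vectors, the new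
    fan satisfies \<open>n \<bullet> x \<ge> R > h\<close>.\<close>
  define R where "R = h + 1"
  have "R > 0" using \<open>h \<ge> 1\<close> by (simp add: R_def)
  define c where "c = (\<lambda>k. R *\<^sub>R a (skip m k))"
  have "\<exists>z. \<forall>k<DIM('a). z \<bullet> c k = r k" for r
  proof -
    define f where "f = (\<lambda>j. r (inv_into {..<DIM('a)} (skip m) j) / R)"
    obtain z where z: "\<forall>j\<le>DIM('a). j \<noteq> m \<longrightarrow> z \<bullet> a j = f j"
      using functional_except[OF m] by blast
    have "f (skip m k) = r k / R" if "k < DIM('a)" for k
      using that skip by (simp add: f_def bij_betw_def)
    then have "z \<bullet> c k = r k" if "k < DIM('a)" for k
      using that z skip' \<open>R > 0\<close> by (simp add: c_def)
    then show ?thesis by blast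
  qed
  then obtain V' w' \<C> where V': "finite V'" "card V' \<le> 2 * DIM('a)" "finite \<C>"
      "card \<C> = 2 ^ (DIM('a) - 1)" "\<And>B. B \<in> \<C> \<Longrightarrow> strict_cell V' w' B"
    and far: "\<And>n h x. (\<And>k. k < DIM('a) \<Longrightarrow> n \<bullet> c k = h) \<Longrightarrow> h > 0 \<Longrightarrow> x \<in> V' \<Longrightarrow> n \<bullet> x \<ge> h / 2"
    and hit': "\<And>B t. B \<in> \<C> \<Longrightarrow> (\<And>k. k < DIM('a) \<Longrightarrow> 0 \<le> t k) \<Longrightarrow> 0 < (\<Sum>k<DIM('a). t k) \<Longrightarrow>
      convex hull B \<inter> ray_from 0 (\<Sum>k<DIM('a). t k *\<^sub>R c k) \<noteq> {}"
    by (rule exists_zigzag_fan) blast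
  have "n \<bullet> c k = 2 * R" if "k < DIM('a)" for k
    using n skip'[OF that] by (simp add: c_def)
  then have "h < n \<bullet> x" if "x \<in> V'" for x
    using far[of n "2 * R" x] that \<open>R > 0\<close> by (simp add: R_def)
  then obtain w'' where w'': "\<forall>B\<in>\<B> \<union> \<C>. strict_cell (V \<union> V') w'' B"
    using strict_cells_glue[OF V(1) V'(1) V(2) V'(3) V(4) V'(5) h_gt] by blast
  have "card (V \<union> V') \<le> Suc DIM('a) + Suc m * (2 * DIM('a))"
    using card_Un_le[of V V'] V(3) V'(2) by simp
  moreover have "convex hull B \<inter> ray_from 0 (\<Sum>j\<le>DIM('a). t j *\<^sub>R a j) \<noteq> {}"
    if B: "B \<in> \<C>" and t: "\<forall>j\<le>DIM('a). 0 \<le> t j" "t m = 0" "0 < (\<Sum>j\<le>DIM('a). t j)" for B t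
  proof -
    \<comment> \<open>The term at \<open>m\<close> vanishes, so omitting it does not change the
      sum.\<close>
    have reindex: "(\<Sum>k<DIM('a). g (skip m k)) = (\<Sum>j\<le>DIM('a). g j)" if "g m = 0"
      for g :: "nat \<Rightarrow> 'b::comm_monoid_add"
    proof -
      have "(\<Sum>k<DIM('a). g (skip m k)) = (\<Sum>j\<in>{..DIM('a)} - {m}. g j)"
        by (rule sum.reindex_bij_betw[OF skip])
      also have "\<dots> = (\<Sum>j\<le>DIM('a). g j)"
        using that by (intro sum.mono_neutral_left) auto
      finally show ?thesis .
    qed
    have "(\<Sum>k<DIM('a). t (skip m k) / R) = (\<Sum>j\<le>DIM('a). t j) / R"
      using reindex[of "\<lambda>j. t j / R"] t(2) by (simp add: sum_divide_distrib)
    moreover have "(\<Sum>k<DIM('a). (t (skip m k) / R) *\<^sub>R c k) = (\<Sum>j\<le>DIM('a). t j *\<^sub>R a j)"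
      using reindex[of "\<lambda>j. t j *\<^sub>R a j"] t(2) \<open>R > 0\<close> by (simp add: c_def)
    ultimately show ?thesis
      using hit'[OF B, of "\<lambda>k. t (skip m k) / R"] t skip'(1) \<open>R > 0\<close> by simp
  qed
  moreover have "\<exists>\<D>\<subseteq>\<B> \<union> \<C>. card \<D> = 2 ^ (DIM('a) - 1) \<and>
      (\<forall>B\<in>\<D>. \<forall>t. (\<forall>j\<le>DIM('a). 0 \<le> t j) \<and> t i = 0 \<and> 0 < (\<Sum>j\<le>DIM('a). t j) \<longrightarrow>
        convex hull B \<inter> ray_from 0 (\<Sum>j\<le>DIM('a). t j *\<^sub>R a j) \<noteq> {})" if "i < m" for i
    using hit[OF that] le_supI1 by blast
  ultimately show ?case
    using V(1,2,5) V'(1,3,4) w''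
    by (intro exI[of _ "V \<union> V'"] exI[of _ w''] exI[of _ "\<B> \<union> \<C>"])
      (auto simp: less_Suc_eq intro!: exI[of _ \<C>])
qed

section \<open>Counting the simplices met by a ray\<close>

proposition exists_heavily_stabbed_triangulation:
  shows "\<exists>(V :: 'a set) \<T> x.
    finite V \<and>
    card V = (2 * DIM('a) + 1) * (DIM('a) + 1) \<and>
    aff_dim (convex hull V) = int DIM('a) \<and>
    triangulation_of \<T> V \<and>
    regular_subdivision_of \<T> V \<and>
    (\<exists>S\<in>\<T>. x \<in> interior S) \<and>
    (\<forall>u. u \<noteq> 0 \<longrightarrow> 2 ^ (DIM('a) - 1) \<le> card {C\<in>\<T>. C \<inter> ray_from x u \<noteq> {}})"
proof -
  obtain V w \<B> where V: "finite V" "finite \<B>" "card V \<le> Suc DIM('a) + Suc DIM('a) * (2 * DIM('a))"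
      "\<And>B. B \<in> \<B> \<Longrightarrow> strict_cell V w B" "a ` {..DIM('a)} \<in> \<B>"
    and hit: "\<And>i. i < Suc DIM('a) \<Longrightarrow> \<exists>\<C>\<subseteq>\<B>. card \<C> = 2 ^ (DIM('a) - 1) \<and>
      (\<forall>B\<in>\<C>. \<forall>t. (\<forall>j\<le>DIM('a). 0 \<le> t j) \<and> t i = 0 \<and> 0 < (\<Sum>j\<le>DIM('a). t j) \<longrightarrow>
        convex hull B \<inter> ray_from 0 (\<Sum>j\<le>DIM('a). t j *\<^sub>R a j) \<noteq> {})"
    using exists_surrounding_fans[of "Suc DIM('a)"] by auto
  let ?N = "(2 * DIM('a) + 1) * (DIM('a) + 1)"
  have "card V \<le> ?N" using V(3) by (simp add: algebra_simps)
  moreover have "3 * (DIM('a) + 1) \<le> ?N"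
    using DIM_positive[where 'a='a] by (intro mult_right_mono) linarith+
  then have "?N \<ge> DIM('a) + 2"
    by (rule order_trans[rotated]) simp
  moreover have "\<B> \<noteq> {}" using V(5) by blast
  ultimately obtain V' \<T> where V': "finite V'" "card V' = ?N"
      "aff_dim (convex hull V') = int DIM('a)" "triangulation_of \<T> V'"
      "regular_subdivision_of \<T> V'" "finite \<T>"
    and cells: "\<And>B. B \<in> \<B> \<Longrightarrow> convex hull B \<in> \<T>" "\<And>B. B \<in> \<B> \<Longrightarrow> \<not> affine_dependent B"
    using strict_cells_extend_to_regular_triangulation[OF V(1,2) _ V(4)] by blast
  have "2 ^ (DIM('a) - 1) \<le> card {C\<in>\<T>. C \<inter> ray_from 0 u \<noteq> {}}" if "u \<noteq> 0" for u
  proof -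
    \<comment> \<open>The ray lies in the cone omitting \<open>a i\<close>, so the cells of the
      \<open>i\<close>-th fan are the ones to count.\<close>
    obtain t i where t: "\<forall>j\<le>DIM('a). 0 \<le> t j" "i \<le> DIM('a)" "t i = 0"
        "u = (\<Sum>j\<le>DIM('a). t j *\<^sub>R a j)"
      using positive_span[of u] by blast
    have "(\<Sum>j\<le>DIM('a). t j) \<noteq> 0"
    proof
      assume "(\<Sum>j\<le>DIM('a). t j) = 0"
      then have "\<forall>j\<in>{..DIM('a)}. t j = 0"
        using t(1) by (subst (asm) sum_nonneg_eq_0_iff) auto
      then show False using t(4) \<open>u \<noteq> 0\<close> by simp
    qed
    moreover have "(\<Sum>j\<le>DIM('a). t j) \<ge> 0" using t(1) by (intro sum_nonneg) auto
    ultimately have "(\<Sum>j\<le>DIM('a). t j) > 0" by simp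
    moreover obtain \<C> where \<C>: "\<C> \<subseteq> \<B>" "card \<C> = 2 ^ (DIM('a) - 1)"
      and "\<forall>B\<in>\<C>. \<forall>t. (\<forall>j\<le>DIM('a). 0 \<le> t j) \<and> t i = 0 \<and> 0 < (\<Sum>j\<le>DIM('a). t j) \<longrightarrow>
        convex hull B \<inter> ray_from 0 (\<Sum>j\<le>DIM('a). t j *\<^sub>R a j) \<noteq> {}"
      using hit[of i] t(2) by auto
    ultimately have meets: "convex hull B \<inter> ray_from 0 u \<noteq> {}" if "B \<in> \<C>" for B
      using t that by blast
    \<comment> \<open>Affine independence recovers a vertex set as the extreme points of its hull,
      so different cells give different simplices.\<close>
    have "inj_on (\<lambda>B. convex hull B) \<C>"
    proof (rule inj_onI)
      fix B B' assume B: "B \<in> \<C>" "B' \<in> \<C>" "convex hull B = convex hull B'"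
      have "{x. x extreme_point_of (convex hull B)} = B" if "B \<in> \<C>" for B
        using extreme_point_of_convex_hull_affine_independent cells(2) \<C>(1) that by blast
      then show "B = B'" using B by metis
    qed
    then have "2 ^ (DIM('a) - 1) = card ((\<lambda>B. convex hull B) ` \<C>)"
      using \<C>(2) by (simp add: card_image)
    also have "\<dots> \<le> card {C\<in>\<T>. C \<inter> ray_from 0 u \<noteq> {}}"
      using meets cells(1) \<C>(1) V'(6) by (intro card_mono) auto
    finally show ?thesis .
  qed
  moreover have "\<exists>S\<in>\<T>. 0 \<in> interior S"
    using center_interior cells(1)[OF V(5)] by blast
  ultimately show ?thesis using V'(1-5) by blast
qed

end

section \<open>A concrete balanced family\<close>

lemma exists_balanced_vectors: "\<exists>a :: nat \<Rightarrow> 'a::euclidean_space. balanced_vectors a"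
proof -
  let ?d = "DIM('a)"
  obtain e where e: "bij_betw e {0..<?d} (Basis :: 'a set)"
    using ex_bij_betw_nat_finite[OF finite_Basis] by blast
  then have e: "bij_betw e {..<?d} (Basis :: 'a set)"
    by (simp add: lessThan_atLeast0)
  have orth: "e i \<bullet> e j = (if i = j then 1 else 0)" if "i < ?d" "j < ?d" for i j
    using that bij_betw_apply[OF e] inj_onD[OF bij_betw_imp_inj_on[OF e], of i j]
    by (auto simp: inner_Basis)
  \<comment> \<open>An orthonormal basis together with the negative of its sum.\<close>
  define a where "a = (\<lambda>j. if j < ?d then e j else - (\<Sum>k<?d. e k))"
  have sum_le: "(\<Sum>j\<le>?d. g j) = (\<Sum>j<?d. g j) + g ?d" for g :: "nat \<Rightarrow> 'b::comm_monoid_add"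
    by (simp add: lessThan_Suc_atMost[symmetric])
  have "balanced_vectors a"
  proof
    show "(\<Sum>j\<le>?d. a j) = 0"
      unfolding sum_le by (simp add: a_def)
  next
    fix f :: "nat \<Rightarrow> real" assume f: "(\<Sum>j\<le>?d. f j) = 0"
    define z where "z = (\<Sum>j<?d. f j *\<^sub>R e j)"
    have ze: "z \<bullet> e k = f k" if "k < ?d" for k
    proof -
      have "z \<bullet> e k = (\<Sum>j<?d. f j * (if j = k then 1 else 0))"
        unfolding z_def inner_sum_left using orth that by (intro sum.cong) auto
      also have "\<dots> = f k"
        using that by (simp add: if_distrib cong: if_cong)
      finally show ?thesis .
    qed
    have "z \<bullet> a ?d = f ?d"
      using f ze unfolding sum_le by (simp add: a_def inner_sum_right)
    then have "\<forall>j\<le>?d. z \<bullet> a j = f j"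
      using ze by (auto simp: a_def le_less)
    then show "\<exists>z. \<forall>j\<le>?d. z \<bullet> a j = f j" by blast
  next
    fix u :: 'a
    \<comment> \<open>Coordinates of \<open>u\<close>, with 0 for the extra vector. Subtracting the
      minimum \<open>m\<close> from all of them leaves the combination unchanged, because the
      vectors sum to 0, and makes one coefficient vanish.\<close>
    define x where "x = (\<lambda>j. if j < ?d then u \<bullet> e j else 0)"
    define m where "m = Min (x ` {..?d})"
    have "m \<in> x ` {..?d}" unfolding m_def by (intro Min_in) auto
    then obtain i where i: "i \<le> ?d" "x i = m" by auto
    have "m \<le> x j" if "j \<le> ?d" for j
      unfolding m_def using that by (intro Min_le) auto
    moreover have "u = (\<Sum>j\<le>?d. (x j - m) *\<^sub>R a j)"
    proof -
      have "u = (\<Sum>b\<in>Basis. (u \<bullet> b) *\<^sub>R b)" by (simp add: euclidean_representation)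
      also have "\<dots> = (\<Sum>j<?d. (u \<bullet> e j) *\<^sub>R e j)"
        by (rule sum.reindex_bij_betw[OF e, symmetric])
      also have "\<dots> = (\<Sum>j\<le>?d. (x j - m) *\<^sub>R a j)"
        unfolding sum_le
        by (simp add: x_def a_def scaleR_diff_left sum_subtractf scaleR_sum_right sum_negf)
      finally show ?thesis .
    qed
    ultimately show "\<exists>t i. (\<forall>j\<le>?d. 0 \<le> t j) \<and> i \<le> ?d \<and> t i = 0 \<and>
        u = (\<Sum>j\<le>?d. t j *\<^sub>R a j)"
      using i by (intro exI[of _ "\<lambda>j. x j - m"] exI[of _ i]) auto
  qed
  then show ?thesis by blast
qed

theorem corollary1p4:
  assumes "CARD('n::finite) \<ge> 3"
  shows "\<exists>(V :: (real^'n) set) \<T> x.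
    finite V \<and>
    card V = (2 * CARD('n) + 1) * (CARD('n) + 1) \<and>
    aff_dim (convex hull V) = int CARD('n) \<and>
    triangulation_of \<T> V \<and>
    regular_subdivision_of \<T> V \<and>
    (\<exists>S\<in>\<T>. x \<in> interior S) \<and>
    (\<forall>u. u \<noteq> 0 \<longrightarrow> 2 ^ (CARD('n) - 1) \<le> card {C\<in>\<T>. C \<inter> ray_from x u \<noteq> {}})"
proof -
  obtain a :: "nat \<Rightarrow> real^'n" where "balanced_vectors a"
    using exists_balanced_vectors by blast
  then show ?thesis
    using balanced_vectors.exists_heavily_stabbed_triangulation[of a] by simp
qed

end
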